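(* If $\mathcal{Q}$ is a small quantaloid in which coreflexive arrows split and $J'$ is a subcanonical Grothendieck topology on $\mathrm{Map}(\mathcal{Q})$, then for each object $C$ of $\mathrm{Map}(\mathcal{Q})$ and each $S\in J'(C)$ we have $\bigvee_{s\in S}s\circ s^*=1_C$. In particular, if $\mathcal{Q}$ is a small quantaloid of closed cribles in which coreflexive arrows split, then the Grothendieck topology $J$ on $\mathrm{Map}(\mathcal{Q})$ defined, for each object $X$, by $$J(X):=\Big\{S \text{ is a sieve on } X \text{ in } \mathrm{Map}(\mathcal{Q})\ \Big|\ 1_X=\bigvee_{s\in S}s\circ s^*\Big\}$$ is the canonical topology on $\mathrm{Map}(\mathcal{Q})$.
   Context: A quantaloid $\mathcal{Q}$ is a category enriched in $\mathrm{Sup}$, the category of complete lattices and supremum-preserving functions: each hom is a complete lattice and composition preserves arbitrary suprema in each variable. It is small if it has a set of objects. Equivalence of quantaloids is meant in the $\mathrm{Sup}$-enriched sense. An arrow $f\colon X\to Y$ is a left adjoint if there is $f^*\colon Y\to X$ (its right adjoint) with $1_X\leq f^*\circ f$ and $f\circ f^*\leq 1_Y$. $\mathrm{Map}(\mathcal{Q})$ is the category with the objects of $\mathcal{Q}$ and the left adjoints of $\mathcal{Q}$ as arrows. A coreflexive arrow in $\mathcal{Q}$ is an arrow $e\colon C\to C$ with $e\leq 1_C$. It splits if there exist arrows $g\colon E\to C$ and $f\colon C\to E$ in $\mathcal{Q}$ with $fg=1_E$ and $gf=e$. "Coreflexive arrows split in $\mathcal{Q}$" means that every coreflexive arrow splits.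 A Grothendieck topology is subcanonical if each representable presheaf is a sheaf for it; the canonical topology is the largest subcanonical Grothendieck topology. In a category $\mathcal{C}$, a span $(f,g)$ from $X$ to $Y$ is a pair of arrows $f\colon U\to Y$, $g\colon U\to X$ with common domain. For a small category $\mathcal{C}$, a crible $R$ from $X$ to $Y$ is a set of spans from $X$ to $Y$ such that $(f,g)\in R$ implies $(f\circ h,g\circ h)\in R$ for every $h$ with codomain $\mathrm{dom}(f)$. The quantaloid $\mathcal{R}(\mathcal{C})$ has the objects of $\mathcal{C}$ as objects and cribles as arrows; for $R\colon X\to Y$ and $S\colon Y\to Z$, $S\circ R$ consists of those $(f,g)$ for which there is $t$ in $\mathcal{C}$ with $(f,t)\in S$ and $(t,g)\in R$; the identity on $X$ is $\{(f,f)\mid \mathrm{cod}(f)=X\}$; suprema of arrows are unions. For a Grothendieck topology $J$ on $\mathcal{C}$ and a crible $R$ from $C$ to $D$, put $$j(R)=\{(f,g)\text{ a span from }C\text{ to }D\mid \exists S\in J(\mathrm{dom}(f)):\ \forall s\in S,\ (f\circ s,g\circ s)\in R\}.$$ The quantaloid $\mathcal{R}(\mathcal{C},J)$ has the objects of $\mathcal{C}$ as objects and the cribles $R$ with $j(R)=R$ as arrows, with composition $j(S\circ R)$, identities $j(\mathrm{id}_X)$ and suprema $j(\bigcup_i R_i)$. A small quantaloid of closed cribles is a small quantaloid equivalent to $\mathcal{R}(\mathcal{C},J)$ for some small site $(\mathcal{C},J)$. It is known that, when $\mathcal{Q}$ is a small quantaloid of closed cribles, the assignment $J$ in the claim is indeed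 a Grothendieck topology on $\mathrm{Map}(\mathcal{Q})$, and that $\mathcal{Q}\cong\mathcal{R}(\mathrm{Map}(\mathcal{Q}),J)$. *)

theory Defs
  imports "HOL-Algebra.Complete_Lattice"
begin

section \<open>Categories\<close>

text \<open>Every HOL type is a set, so all categories below are small. \<open>g \<cdot> f\<close> is meaningful only
  if \<open>Dom g = Cod f\<close>.\<close>

record ('o, 'm) cat =
  Ob :: "'o set"
  Arr :: "'m set"
  Dom :: "'m \<Rightarrow> 'o"
  Cod :: "'m \<Rightarrow> 'o"
  Id :: "'o \<Rightarrow> 'm"
  Comp :: "'m \<Rightarrow> 'm \<Rightarrow> 'm" (infixr "\<cdot>\<index>" 70)

definition Hom :: "('o, 'm, 'z) cat_scheme \<Rightarrow> 'o \<Rightarrow> 'o \<Rightarrow> 'm set" where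
  "Hom C X Y = {f \<in> Arr C. Dom C f = X \<and> Cod C f = Y}"

locale category =
  fixes C :: "('o, 'm, 'z) cat_scheme" (structure)
  assumes dom_in_Ob: "f \<in> Arr C \<Longrightarrow> Dom C f \<in> Ob C"
    and cod_in_Ob: "f \<in> Arr C \<Longrightarrow> Cod C f \<in> Ob C"
    and id_in_Hom: "X \<in> Ob C \<Longrightarrow> Id C X \<in> Hom C X X"
    and comp_in_Hom: "f \<in> Hom C X Y \<Longrightarrow> g \<in> Hom C Y Z \<Longrightarrow> g \<cdot> f \<in> Hom C X Z"
    and comp_id: "f \<in> Hom C X Y \<Longrightarrow> f \<cdot> Id C X = f"
    and id_comp: "f \<in> Hom C X Y \<Longrightarrow> Id C Y \<cdot> f = f"
    and comp_assoc: "f \<in> Hom C W X \<Longrightarrow> g \<in> Hom C X Y \<Longrightarrow> h \<in> Hom C Y Z \<Longrightarrow>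
      (h \<cdot> g) \<cdot> f = h \<cdot> (g \<cdot> f)"

definition is_iso :: "('o, 'm, 'z) cat_scheme \<Rightarrow> 'o \<Rightarrow> 'o \<Rightarrow> 'm \<Rightarrow> bool" where
  "is_iso C X Y f \<longleftrightarrow> f \<in> Hom C X Y \<and>
     (\<exists>g \<in> Hom C Y X. g \<cdot>\<^bsub>C\<^esub> f = Id C X \<and> f \<cdot>\<^bsub>C\<^esub> g = Id C Y)"

definition is_functor ::
  "('o, 'm, 'y) cat_scheme \<Rightarrow> ('p, 'n, 'z) cat_scheme \<Rightarrow> ('o \<Rightarrow> 'p) \<Rightarrow> ('m \<Rightarrow> 'n) \<Rightarrow> bool" where
  "is_functor C D Fo Fa \<longleftrightarrow>
     (\<forall>X \<in> Ob C. Fo X \<in> Ob D \<and> Fa (Id C X) = Id D (Fo X)) \<and>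
     (\<forall>f \<in> Arr C. Fa f \<in> Hom D (Fo (Dom C f)) (Fo (Cod C f))) \<and>
     (\<forall>f \<in> Arr C. \<forall>g \<in> Arr C. Dom C g = Cod C f \<longrightarrow> Fa (g \<cdot>\<^bsub>C\<^esub> f) = Fa g \<cdot>\<^bsub>D\<^esub> Fa f)"

definition natural_iso ::
  "('o, 'm, 'y) cat_scheme \<Rightarrow> ('p, 'n, 'z) cat_scheme \<Rightarrow>
   ('o \<Rightarrow> 'p) \<Rightarrow> ('m \<Rightarrow> 'n) \<Rightarrow> ('o \<Rightarrow> 'p) \<Rightarrow> ('m \<Rightarrow> 'n) \<Rightarrow> ('o \<Rightarrow> 'n) \<Rightarrow> bool" where
  "natural_iso C D Fo Fa Go Ga \<eta> \<longleftrightarrow>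
     (\<forall>X \<in> Ob C. is_iso D (Fo X) (Go X) (\<eta> X)) \<and>
     (\<forall>f \<in> Arr C. Ga f \<cdot>\<^bsub>D\<^esub> \<eta> (Dom C f) = \<eta> (Cod C f) \<cdot>\<^bsub>D\<^esub> Fa f)"


section \<open>Sites and sheaves\<close>

definition is_sieve :: "('o, 'm, 'z) cat_scheme \<Rightarrow> 'o \<Rightarrow> 'm set \<Rightarrow> bool" where
  "is_sieve C X S \<longleftrightarrow> S \<subseteq> {s \<in> Arr C. Cod C s = X} \<and>
     (\<forall>s \<in> S. \<forall>h \<in> Arr C. Cod C h = Dom C s \<longrightarrow> s \<cdot>\<^bsub>C\<^esub> h \<in> S)"

definition sieve_pullback :: "('o, 'm, 'z) cat_scheme \<Rightarrow> 'm \<Rightarrow> 'm set \<Rightarrow> 'm set" where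
  "sieve_pullback C f S = {h \<in> Arr C. Cod C h = Dom C f \<and> f \<cdot>\<^bsub>C\<^esub> h \<in> S}"

definition grothendieck_topology ::
  "('o, 'm, 'z) cat_scheme \<Rightarrow> ('o \<Rightarrow> 'm set set) \<Rightarrow> bool" where
  "grothendieck_topology C J \<longleftrightarrow>
     (\<forall>X \<in> Ob C. \<forall>S \<in> J X. is_sieve C X S) \<and>
     (\<forall>X \<in> Ob C. {s \<in> Arr C. Cod C s = X} \<in> J X) \<and>
     (\<forall>X \<in> Ob C. \<forall>S \<in> J X. \<forall>f \<in> Arr C. Cod C f = X \<longrightarrow>
        sieve_pullback C f S \<in> J (Dom C f)) \<and>
     (\<forall>X \<in> Ob C. \<forall>S \<in> J X. \<forall>R. is_sieve C X R \<longrightarrow>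
        (\<forall>s \<in> S. sieve_pullback C s R \<in> J (Dom C s)) \<longrightarrow> R \<in> J X)"

record ('o, 'm, 'x) psh =
  Sec :: "'o \<Rightarrow> 'x set"
  Res :: "'m \<Rightarrow> 'x \<Rightarrow> 'x"

definition presheaf :: "('o, 'm, 'z) cat_scheme \<Rightarrow> ('o, 'm, 'x) psh \<Rightarrow> bool" where
  "presheaf C P \<longleftrightarrow>
     (\<forall>h \<in> Arr C. \<forall>x \<in> Sec P (Cod C h). Res P h x \<in> Sec P (Dom C h)) \<and>
     (\<forall>X \<in> Ob C. \<forall>x \<in> Sec P X. Res P (Id C X) x = x) \<and>
     (\<forall>h \<in> Arr C. \<forall>k \<in> Arr C. Cod C k = Dom C h \<longrightarrow>
        (\<forall>x \<in> Sec P (Cod C h). Res P (h \<cdot>\<^bsub>C\<^esub> k) x = Res P k (Res P h x)))"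

definition representable :: "('o, 'm, 'z) cat_scheme \<Rightarrow> 'o \<Rightarrow> ('o, 'm, 'm) psh" where
  "representable C Y = \<lparr>Sec = (\<lambda>X. Hom C X Y), Res = (\<lambda>h x. x \<cdot>\<^bsub>C\<^esub> h)\<rparr>"

definition matching_family ::
  "('o, 'm, 'z) cat_scheme \<Rightarrow> ('o, 'm, 'x) psh \<Rightarrow> 'm set \<Rightarrow> ('m \<Rightarrow> 'x) \<Rightarrow> bool" where
  "matching_family C P S x \<longleftrightarrow>
     (\<forall>s \<in> S. x s \<in> Sec P (Dom C s)) \<and>
     (\<forall>s \<in> S. \<forall>h \<in> Arr C. Cod C h = Dom C s \<longrightarrow> x (s \<cdot>\<^bsub>C\<^esub> h) = Res P h (x s))"

definition sheaf ::
  "('o, 'm, 'z) cat_scheme \<Rightarrow> ('o \<Rightarrow> 'm set set) \<Rightarrow> ('o, 'm, 'x) psh \<Rightarrow> bool" where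
  "sheaf C J P \<longleftrightarrow> presheaf C P \<and>
     (\<forall>X \<in> Ob C. \<forall>S \<in> J X. \<forall>x. matching_family C P S x \<longrightarrow>
        (\<exists>!a. a \<in> Sec P X \<and> (\<forall>s \<in> S. Res P s a = x s)))"

definition subcanonical :: "('o, 'm, 'z) cat_scheme \<Rightarrow> ('o \<Rightarrow> 'm set set) \<Rightarrow> bool" where
  "subcanonical C J \<longleftrightarrow>
     grothendieck_topology C J \<and> (\<forall>Y \<in> Ob C. sheaf C J (representable C Y))"

text \<open>Values of a topology outside \<open>Ob C\<close> are irrelevant, so topologies are compared on
  \<open>Ob C\<close> only.\<close>

definition canonical_topology :: "('o, 'm, 'z) cat_scheme \<Rightarrow> ('o \<Rightarrow> 'm set set) \<Rightarrow> bool" where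
  "canonical_topology C J \<longleftrightarrow>
     subcanonical C J \<and> (\<forall>J'. subcanonical C J' \<longrightarrow> (\<forall>X \<in> Ob C. J' X \<subseteq> J X))"


section \<open>Quantaloids\<close>

text \<open>\<open>Le\<close> is only meaningful between parallel arrows.\<close>

record ('o, 'm) qtld = "('o, 'm) cat" +
  Le :: "'m \<Rightarrow> 'm \<Rightarrow> bool"

definition hom_order :: "('o, 'm, 'z) qtld_scheme \<Rightarrow> 'o \<Rightarrow> 'o \<Rightarrow> 'm gorder" where
  "hom_order Q X Y = \<lparr>carrier = Hom Q X Y, eq = (=), le = Le Q\<rparr>"

locale quantaloid = category Q for Q :: "('o, 'm, 'z) qtld_scheme" (structure) +
  assumes hom_complete_lattice:
      "X \<in> Ob Q \<Longrightarrow> Y \<in> Ob Q \<Longrightarrow> complete_lattice (hom_order Q X Y)"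
    and comp_Sup_right: "X \<in> Ob Q \<Longrightarrow> g \<in> Hom Q Y Z \<Longrightarrow>
      sup_pres (hom_order Q X Y) (hom_order Q X Z) (\<lambda>f. g \<cdot> f)"
    and comp_Sup_left: "Z \<in> Ob Q \<Longrightarrow> f \<in> Hom Q X Y \<Longrightarrow>
      sup_pres (hom_order Q Y Z) (hom_order Q X Z) (\<lambda>g. g \<cdot> f)"

definition sup_functor ::
  "('o, 'm, 'y) qtld_scheme \<Rightarrow> ('p, 'n, 'z) qtld_scheme \<Rightarrow> ('o \<Rightarrow> 'p) \<Rightarrow> ('m \<Rightarrow> 'n) \<Rightarrow> bool" where
  "sup_functor A B Fo Fa \<longleftrightarrow> is_functor A B Fo Fa \<and>
     (\<forall>X \<in> Ob A. \<forall>Y \<in> Ob A. sup_pres (hom_order A X Y) (hom_order B (Fo X) (Fo Y)) Fa)"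

text \<open>A \<open>Sup\<close>-natural transformation is just a natural transformation of the underlying functors,
  because the forgetful functor from \<open>Sup\<close> to sets is faithful.\<close>

definition quantaloid_equivalent ::
  "('o, 'm, 'y) qtld_scheme \<Rightarrow> ('p, 'n, 'z) qtld_scheme \<Rightarrow> bool" where
  "quantaloid_equivalent A B \<longleftrightarrow>
     (\<exists>Fo Fa Go Ga \<eta> \<epsilon>. sup_functor A B Fo Fa \<and> sup_functor B A Go Ga \<and>
        natural_iso A A id id (Go \<circ> Fo) (Ga \<circ> Fa) \<eta> \<and>
        natural_iso B B (Fo \<circ> Go) (Fa \<circ> Ga) id id \<epsilon>)"

definition adjoint :: "('o, 'm, 'z) qtld_scheme \<Rightarrow> 'm \<Rightarrow> 'm \<Rightarrow> bool" where
  "adjoint Q f g \<longleftrightarrow> f \<in> Arr Q \<and> g \<in> Hom Q (Cod Q f) (Dom Q f) \<and>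
     Le Q (Id Q (Dom Q f)) (g \<cdot>\<^bsub>Q\<^esub> f) \<and> Le Q (f \<cdot>\<^bsub>Q\<^esub> g) (Id Q (Cod Q f))"

definition right_adjoint :: "('o, 'm, 'z) qtld_scheme \<Rightarrow> 'm \<Rightarrow> 'm" where
  "right_adjoint Q f = (THE g. adjoint Q f g)"

definition Map_cat :: "('o, 'm, 'z) qtld_scheme \<Rightarrow> ('o, 'm) cat" where
  "Map_cat Q = \<lparr>Ob = Ob Q, Arr = {f. \<exists>g. adjoint Q f g}, Dom = Dom Q, Cod = Cod Q,
     Id = Id Q, Comp = Comp Q\<rparr>"

definition coreflexives_split :: "('o, 'm, 'z) qtld_scheme \<Rightarrow> bool" where
  "coreflexives_split Q \<longleftrightarrow>
     (\<forall>C \<in> Ob Q. \<forall>e \<in> Hom Q C C. Le Q e (Id Q C) \<longrightarrow>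
        (\<exists>E \<in> Ob Q. \<exists>g \<in> Hom Q E C. \<exists>f \<in> Hom Q C E. f \<cdot>\<^bsub>Q\<^esub> g = Id Q E \<and> g \<cdot>\<^bsub>Q\<^esub> f = e))"

definition sieve_Sup :: "('o, 'm, 'z) qtld_scheme \<Rightarrow> 'o \<Rightarrow> 'm set \<Rightarrow> 'm" where
  "sieve_Sup Q X S = \<Squnion>\<^bsub>hom_order Q X X\<^esub> {s \<cdot>\<^bsub>Q\<^esub> right_adjoint Q s | s. s \<in> S}"

definition Map_topology :: "('o, 'm, 'z) qtld_scheme \<Rightarrow> 'o \<Rightarrow> 'm set set" where
  "Map_topology Q X = {S. is_sieve (Map_cat Q) X S \<and> Id Q X = sieve_Sup Q X S}"


section \<open>Quantaloids of closed cribles\<close>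

definition spans :: "('o, 'm, 'z) cat_scheme \<Rightarrow> 'o \<Rightarrow> 'o \<Rightarrow> ('m \<times> 'm) set" where
  "spans C X Y = {(f, g). \<exists>U \<in> Ob C. f \<in> Hom C U Y \<and> g \<in> Hom C U X}"

definition crible :: "('o, 'm, 'z) cat_scheme \<Rightarrow> 'o \<Rightarrow> 'o \<Rightarrow> ('m \<times> 'm) set \<Rightarrow> bool" where
  "crible C X Y R \<longleftrightarrow> R \<subseteq> spans C X Y \<and>
     (\<forall>(f, g) \<in> R. \<forall>h \<in> Arr C. Cod C h = Dom C f \<longrightarrow> (f \<cdot>\<^bsub>C\<^esub> h, g \<cdot>\<^bsub>C\<^esub> h) \<in> R)"

definition crible_closure ::
  "('o, 'm, 'z) cat_scheme \<Rightarrow> ('o \<Rightarrow> 'm set set) \<Rightarrow> 'o \<Rightarrow> 'o \<Rightarrow> ('m \<times> 'm) set \<Rightarrow> ('m \<times> 'm) set" where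
  "crible_closure C J X Y R =
     {(f, g) \<in> spans C X Y. \<exists>S \<in> J (Dom C f). \<forall>s \<in> S. (f \<cdot>\<^bsub>C\<^esub> s, g \<cdot>\<^bsub>C\<^esub> s) \<in> R}"

text \<open>An arrow \<open>R: X \<rightarrow> Y\<close> is the triple \<open>(X, Y, R)\<close>, since the same set of spans (such as the
  empty one) may be a crible between different objects. The composite \<open>S \<circ> R\<close> of cribles is the
  relational composite \<open>S O R\<close>. The order is inclusion, for which the supremum of a family
  \<open>R\<^sub>i\<close> of closed cribles is the closure of its union.\<close>

definition closed_cribles ::
  "('o, 'm, 'z) cat_scheme \<Rightarrow> ('o \<Rightarrow> 'm set set) \<Rightarrow> ('o, 'o \<times> 'o \<times> ('m \<times> 'm) set) qtld" where
  "closed_cribles C J =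
     \<lparr>Ob = Ob C,
      Arr = {(X, Y, R). X \<in> Ob C \<and> Y \<in> Ob C \<and> crible C X Y R \<and> crible_closure C J X Y R = R},
      Dom = (\<lambda>(X, Y, R). X),
      Cod = (\<lambda>(X, Y, R). Y),
      Id = (\<lambda>X. (X, X, crible_closure C J X X (Id_on {f \<in> Arr C. Cod C f = X}))),
      Comp = (\<lambda>(Y', Z, S) (X, Y, R). (X, Z, crible_closure C J X Z (S O R))),
      Le = (\<lambda>(X, Y, R) (X', Y', R'). R \<subseteq> R')\<rparr>"

text \<open>The type argument carries the types of objects and arrows of the site: HOL cannot quantify
  existentially over types. In a hypothesis, leaving them as type variables is the same as
  allowing an arbitrary small site.\<close>

definition quantaloid_of_closed_cribles ::
  "('c \<times> 'a) itself \<Rightarrow> ('o, 'm, 'z) qtld_scheme \<Rightarrow> bool" where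
  "quantaloid_of_closed_cribles T Q \<longleftrightarrow> quantaloid Q \<and>
     (\<exists>(C :: ('c, 'a) cat) J. category C \<and> grothendieck_topology C J \<and>
        quantaloid_equivalent Q (closed_cribles C J))"

end

theory Submission
  imports Defs
begin

text \<open>If \<open>S\<close> covers \<open>X\<close> for a subcanonical topology, split the coreflexive \<open>\<Or> s \<cdot> s\<^sup>*\<close> as
  \<open>g \<cdot> f\<close>: every \<open>s \<in> S\<close> factors through the subobject \<open>g\<close>, so the sheaf property makes \<open>g\<close>
  invertible.

  For the second claim, three properties of closed cribles are transported to \<open>Q\<close>: comparable left
  adjoints are equal, every arrow is the supremum of the \<open>f \<cdot> g\<^sup>*\<close> below it, and if
  \<open>1\<^sub>Y \<le> \<Or> q\<^sub>i \<cdot> p\<^sub>i\<close> then \<open>1\<^sub>Y\<close> is the supremum of those \<open>h \<cdot> h\<^sup>*\<close> such that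
  \<open>k \<cdot> h\<^sup>* \<le> p\<^sub>i\<close> for some \<open>i\<close> and some left adjoint \<open>k\<close>. The last one replaces the
  distributivity of the hom-lattices and the modular law in the proof that covers are stable under
  pullback.\<close>

text \<open>It helps to read an arrow of closed cribles as a relation between generalized elements,
  that is, arrows of the site. Left adjoints are then the total single valued relations, and every
  relation is covered by spans. If composites \<open>q \<cdot> p\<close> cover the identity of
  \<open>Y\<close>, each element \<open>h\<close> of \<open>Y\<close> is locally related by some
  \<open>p\<close> to an element \<open>k\<close>; this is the origin of the third property.

  The obstacle is that "total" and "single valued" hold only after passing to covers, so a left
  adjoint between closed cribles need not be the graph of an arrow of the site, and the category of
  all left adjoints has no handy description. It is therefore never computed. The graphs alone
  supply enough left adjoints to test inequalities, and their images \<open>pt\<close> and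
  \<open>copt\<close> do the same in \<open>Q\<close>.

  The transported properties show that \<open>Map_topology Q\<close> is a subcanonical topology; the
  first claim then says that it is the largest one.\<close>

lemma HomI: "f \<in> Arr C \<Longrightarrow> Dom C f = X \<Longrightarrow> Cod C f = Y \<Longrightarrow> f \<in> Hom C X Y"
  by (simp add: Hom_def)

lemma HomD:
  assumes "f \<in> Hom C X Y"
  shows "f \<in> Arr C" "Dom C f = X" "Cod C f = Y"
  using assms by (simp_all add: Hom_def)

lemma (in category) Hom_Ob:
  assumes "f \<in> Hom C X Y"
  shows "X \<in> Ob C" "Y \<in> Ob C"
  using assms dom_in_Ob cod_in_Ob by (auto simp: Hom_def)

lemma hom_order_simps [simp]:
  "carrier (hom_order Q X Y) = Hom Q X Y" "le (hom_order Q X Y) = Le Q"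
  by (simp_all add: hom_order_def)

text \<open>The order is recovered from suprema: \<open>x\<close> lies below \<open>y\<close>
  exactly when \<open>y\<close> is the supremum of the two.\<close>

lemma sup_pres_mono:
  assumes sp: "sup_pres L M \<phi>" and maps: "\<And>a. a \<in> carrier L \<Longrightarrow> \<phi> a \<in> carrier M"
    and xy: "x \<in> carrier L" "y \<in> carrier L" "x \<sqsubseteq>\<^bsub>L\<^esub> y"
  shows "\<phi> x \<sqsubseteq>\<^bsub>M\<^esub> \<phi> y"
proof -
  interpret L: complete_lattice L using sp by (simp add: sup_pres_def)
  interpret M: complete_lattice M using sp by (simp add: sup_pres_def)
  have "\<Squnion>\<^bsub>L\<^esub>{x, y} = y"
    using xy by (intro L.le_antisym L.sup_least L.sup_upper) auto
  then have "\<phi> y = \<Squnion>\<^bsub>M\<^esub>{\<phi> x, \<phi> y}"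
    using sp xy by (auto simp: sup_pres_def dest!: spec[of _ "{x, y}"])
  then show ?thesis
    using M.sup_upper[of "{\<phi> x, \<phi> y}" "\<phi> x"] maps xy by auto
qed

section \<open>Adjunctions in a quantaloid\<close>

context quantaloid
begin

section \<open>Order and suprema in the hom-lattices\<close>

lemma le_refl: "f \<in> Hom Q X Y \<Longrightarrow> Le Q f f"
proof -
  assume f: "f \<in> Hom Q X Y"
  interpret L: complete_lattice "hom_order Q X Y"
    using hom_complete_lattice Hom_Ob[OF f] by blast
  show ?thesis using L.le_refl f by simp
qed

lemma le_trans:
  assumes "f \<in> Hom Q X Y" "g \<in> Hom Q X Y" "h \<in> Hom Q X Y" "Le Q f g" "Le Q g h"
  shows "Le Q f h"
proof -
  interpret L: complete_lattice "hom_order Q X Y"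
    using hom_complete_lattice Hom_Ob[OF assms(1)] by blast
  show ?thesis using L.le_trans[of f g h] assms by simp
qed

lemma le_antisym:
  assumes "f \<in> Hom Q X Y" "g \<in> Hom Q X Y" "Le Q f g" "Le Q g f"
  shows "f = g"
proof -
  interpret L: complete_lattice "hom_order Q X Y"
    using hom_complete_lattice Hom_Ob[OF assms(1)] by blast
  show ?thesis using L.le_antisym[of f g] assms by simp
qed

lemma Sup_Hom:
  assumes "X \<in> Ob Q" "Y \<in> Ob Q" "A \<subseteq> Hom Q X Y"
  shows "\<Squnion>\<^bsub>hom_order Q X Y\<^esub> A \<in> Hom Q X Y"
proof -
  interpret L: complete_lattice "hom_order Q X Y"
    using hom_complete_lattice assms by blast
  show ?thesis using L.sup_closed[of A] assms by simp
qed

lemma Sup_upper: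
  assumes "A \<subseteq> Hom Q X Y" "f \<in> A"
  shows "Le Q f (\<Squnion>\<^bsub>hom_order Q X Y\<^esub> A)"
proof -
  interpret L: complete_lattice "hom_order Q X Y"
    using hom_complete_lattice Hom_Ob[of f] assms by blast
  show ?thesis using L.sup_upper[of A f] assms by simp
qed

lemma Sup_least:
  assumes "A \<subseteq> Hom Q X Y" "g \<in> Hom Q X Y" "\<And>f. f \<in> A \<Longrightarrow> Le Q f g"
  shows "Le Q (\<Squnion>\<^bsub>hom_order Q X Y\<^esub> A) g"
proof -
  interpret L: complete_lattice "hom_order Q X Y"
    using hom_complete_lattice Hom_Ob[OF assms(2)] by blast
  show ?thesis using L.sup_least[of A g] assms by simp
qed

lemma comp_mono_right:
  assumes "f \<in> Hom Q X Y" "f' \<in> Hom Q X Y" "g \<in> Hom Q Y Z" "Le Q f f'"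
  shows "Le Q (g \<cdot> f) (g \<cdot> f')"
  using sup_pres_mono[OF comp_Sup_right[of X g Y Z], of f f'] assms Hom_Ob comp_in_Hom by simp

lemma comp_mono_left:
  assumes "f \<in> Hom Q X Y" "g \<in> Hom Q Y Z" "g' \<in> Hom Q Y Z" "Le Q g g'"
  shows "Le Q (g \<cdot> f) (g' \<cdot> f)"
  using sup_pres_mono[OF comp_Sup_left[of Z f X Y], of g g'] assms Hom_Ob comp_in_Hom by simp

lemma comp_Sup_le:
  assumes "A \<subseteq> Hom Q X Y" "X \<in> Ob Q" "g \<in> Hom Q Y Z" "h \<in> Hom Q X Z"
    and "\<And>f. f \<in> A \<Longrightarrow> Le Q (g \<cdot> f) h"
  shows "Le Q (g \<cdot> \<Squnion>\<^bsub>hom_order Q X Y\<^esub> A) h"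
proof -
  have "g \<cdot> \<Squnion>\<^bsub>hom_order Q X Y\<^esub> A = \<Squnion>\<^bsub>hom_order Q X Z\<^esub> ((\<lambda>f. g \<cdot> f) ` A)"
    using comp_Sup_right[of X g Y Z] assms by (simp add: sup_pres_def)
  moreover have "(\<lambda>f. g \<cdot> f) ` A \<subseteq> Hom Q X Z" using assms(1,3) comp_in_Hom by blast
  ultimately show ?thesis using Sup_least[of "(\<lambda>f. g \<cdot> f) ` A" X Z h] assms(4,5) by force
qed

lemma Sup_comp_le:
  assumes "A \<subseteq> Hom Q Y Z" "Z \<in> Ob Q" "f \<in> Hom Q X Y" "h \<in> Hom Q X Z"
    and "\<And>g. g \<in> A \<Longrightarrow> Le Q (g \<cdot> f) h"
  shows "Le Q ((\<Squnion>\<^bsub>hom_order Q Y Z\<^esub> A) \<cdot> f) h"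
proof -
  have "(\<Squnion>\<^bsub>hom_order Q Y Z\<^esub> A) \<cdot> f = \<Squnion>\<^bsub>hom_order Q X Z\<^esub> ((\<lambda>g. g \<cdot> f) ` A)"
    using comp_Sup_left[of Z f X Y] assms by (simp add: sup_pres_def)
  moreover have "(\<lambda>g. g \<cdot> f) ` A \<subseteq> Hom Q X Z" using assms(1,3) comp_in_Hom by blast
  ultimately show ?thesis using Sup_least[of "(\<lambda>g. g \<cdot> f) ` A" X Z h] assms(4,5) by force
qed

lemma comp_Sup_comp_le:
  assumes A: "A \<subseteq> Hom Q X Y" "X \<in> Ob Q" and f: "f \<in> Hom Q W X" and g: "g \<in> Hom Q Y Z"
    and h: "h \<in> Hom Q W Z" and le: "\<And>a. a \<in> A \<Longrightarrow> Le Q ((g \<cdot> a) \<cdot> f) h"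
  shows "Le Q ((g \<cdot> \<Squnion>\<^bsub>hom_order Q X Y\<^esub> A) \<cdot> f) h"
proof -
  have "g \<cdot> \<Squnion>\<^bsub>hom_order Q X Y\<^esub> A = \<Squnion>\<^bsub>hom_order Q X Z\<^esub> ((\<lambda>a. g \<cdot> a) ` A)"
    using comp_Sup_right[OF A(2) g] A(1) by (simp add: sup_pres_def)
  moreover have "(\<lambda>a. g \<cdot> a) ` A \<subseteq> Hom Q X Z" using A g comp_in_Hom by blast
  ultimately show ?thesis
    using Sup_comp_le[of "(\<lambda>a. g \<cdot> a) ` A" X Z f W h] Hom_Ob(2)[OF g] f h le by force
qed

section \<open>Calculus of adjoint arrows\<close>

lemma adjointI:
  assumes "f \<in> Hom Q X Y" "g \<in> Hom Q Y X" "Le Q (Id Q X) (g \<cdot> f)" "Le Q (f \<cdot> g) (Id Q Y)"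
  shows "adjoint Q f g"
  using assms by (auto simp: adjoint_def Hom_def)

lemma adjointD:
  assumes "adjoint Q f g" "f \<in> Hom Q X Y"
  shows "g \<in> Hom Q Y X" "Le Q (Id Q X) (g \<cdot> f)" "Le Q (f \<cdot> g) (Id Q Y)"
  using assms by (auto simp: adjoint_def Hom_def)

text \<open>Unit and counit make composition with \<open>f\<close> and with \<open>f'\<close> a
  Galois connection between hom-lattices. Most later inequalities are moved across it, which avoids
  inserting units and counits by hand.\<close>

lemma adjoint_left_iff:
  assumes a: "adjoint Q f f'" and f: "f \<in> Hom Q X Y" and p: "p \<in> Hom Q U X" and q: "q \<in> Hom Q U Y"
  shows "Le Q (f \<cdot> p) q \<longleftrightarrow> Le Q p (f' \<cdot> q)"
proof
  note f' = adjointD[OF a f]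
  have t: "f \<cdot> p \<in> Hom Q U Y" "f' \<cdot> q \<in> Hom Q U X" "f' \<cdot> f \<in> Hom Q X X" "f \<cdot> f' \<in> Hom Q Y Y"
    "Id Q X \<in> Hom Q X X" "Id Q Y \<in> Hom Q Y Y"
    using f f' p q comp_in_Hom id_in_Hom Hom_Ob by blast+
  { assume "Le Q (f \<cdot> p) q"
    then have "Le Q (f' \<cdot> (f \<cdot> p)) (f' \<cdot> q)"
      using comp_mono_right t f' q by blast
    moreover have "Le Q (Id Q X \<cdot> p) ((f' \<cdot> f) \<cdot> p)"
      using comp_mono_left t f' p by blast
    ultimately show "Le Q p (f' \<cdot> q)"
      using le_trans[OF p comp_in_Hom[OF t(1) f'(1)] t(2)]
      by (simp add: comp_assoc[OF p f f'(1)] id_comp[OF p]) }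
  { assume "Le Q p (f' \<cdot> q)"
    then have "Le Q (f \<cdot> p) (f \<cdot> (f' \<cdot> q))"
      using comp_mono_right t f p by blast
    moreover have "Le Q ((f \<cdot> f') \<cdot> q) (Id Q Y \<cdot> q)"
      using comp_mono_left t f' q by blast
    ultimately show "Le Q (f \<cdot> p) q"
      using le_trans[OF t(1) comp_in_Hom[OF t(2) f] q]
      by (simp add: comp_assoc[OF q f'(1) f] id_comp[OF q]) }
qed

text \<open>The mirror image: under precomposition the roles are exchanged, and \<open>f'\<close>
  induces the lower adjoint.\<close>

lemma adjoint_right_iff:
  assumes a: "adjoint Q f f'" and f: "f \<in> Hom Q X Y" and p: "p \<in> Hom Q X U" and q: "q \<in> Hom Q Y U"
  shows "Le Q (p \<cdot> f') q \<longleftrightarrow> Le Q p (q \<cdot> f)"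
proof
  note f' = adjointD[OF a f]
  have t: "q \<cdot> f \<in> Hom Q X U" "p \<cdot> f' \<in> Hom Q Y U" "f' \<cdot> f \<in> Hom Q X X" "f \<cdot> f' \<in> Hom Q Y Y"
    "Id Q X \<in> Hom Q X X" "Id Q Y \<in> Hom Q Y Y"
    using f f' p q comp_in_Hom id_in_Hom Hom_Ob by blast+
  { assume "Le Q (p \<cdot> f') q"
    then have "Le Q ((p \<cdot> f') \<cdot> f) (q \<cdot> f)"
      using comp_mono_left t f q by blast
    moreover have "Le Q (p \<cdot> Id Q X) (p \<cdot> (f' \<cdot> f))"
      using comp_mono_right t f' p by blast
    ultimately show "Le Q p (q \<cdot> f)"
      using le_trans[OF p comp_in_Hom[OF t(3) p] t(1)]
      by (simp add: comp_assoc[OF f f'(1) p] comp_id[OF p]) }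
  { assume "Le Q p (q \<cdot> f)"
    then have "Le Q (p \<cdot> f') ((q \<cdot> f) \<cdot> f')"
      using comp_mono_left t f' p by blast
    moreover have "Le Q (q \<cdot> (f \<cdot> f')) (q \<cdot> Id Q Y)"
      using comp_mono_right t f' q by blast
    ultimately show "Le Q (p \<cdot> f') q"
      using le_trans[OF t(2) comp_in_Hom[OF t(4) q] q]
      by (simp add: comp_assoc[OF f'(1) f q] comp_id[OF q]) }
qed

lemma adjoint_Hom:
  assumes "adjoint Q f g"
  shows "f \<in> Hom Q (Dom Q f) (Cod Q f)"
  using assms by (simp add: adjoint_def Hom_def)

text \<open>Transpose \<open>f \<cdot> g' \<le> g \<cdot> g' \<le> 1\<close> along the adjunction of
  \<open>f\<close>. Taking \<open>f\<close> and \<open>g\<close> equal gives uniqueness of right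
  adjoints.\<close>

lemma adjoint_antimono:
  assumes "adjoint Q f f'" "adjoint Q g g'" "f \<in> Hom Q X Y" "g \<in> Hom Q X Y" "Le Q f g"
  shows "Le Q g' f'"
proof -
  have f': "f' \<in> Hom Q Y X" and g': "g' \<in> Hom Q Y X" using adjointD assms by blast+
  have "Le Q (f \<cdot> g') (g \<cdot> g')" using comp_mono_left assms g' by blast
  then have "Le Q (f \<cdot> g') (Id Q Y)"
    using le_trans[of "f \<cdot> g'" Y Y "g \<cdot> g'" "Id Q Y"] adjointD(3)[OF assms(2,4)]
      comp_in_Hom id_in_Hom Hom_Ob assms(3,4) g' by blast
  then show ?thesis
    using adjoint_left_iff[OF assms(1,3) g', of "Id Q Y"] id_in_Hom[of Y] Hom_Ob[OF f'] comp_id[OF f']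
    by metis
qed

lemma adjoint_unique:
  assumes "adjoint Q f g" "adjoint Q f h"
  shows "g = h"
  using adjoint_antimono assms adjoint_Hom[OF assms(1)] le_refl le_antisym adjointD by meson

lemma right_adjoint_eq: "adjoint Q f g \<Longrightarrow> right_adjoint Q f = g"
  unfolding right_adjoint_def using adjoint_unique by blast

lemma adjoint_comp:
  assumes "adjoint Q f f'" "adjoint Q g g'" "f \<in> Hom Q X Y" "g \<in> Hom Q Y Z"
  shows "adjoint Q (g \<cdot> f) (f' \<cdot> g')"
proof (rule adjointI)
  have f': "f' \<in> Hom Q Y X" and g': "g' \<in> Hom Q Z Y" using adjointD assms by blast+
  show gf: "g \<cdot> f \<in> Hom Q X Z" and gf': "f' \<cdot> g' \<in> Hom Q Z X"
    using f' g' assms comp_in_Hom by blast+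
  have iX: "Id Q X \<in> Hom Q X X" and iZ: "Id Q Z \<in> Hom Q Z Z"
    using id_in_Hom Hom_Ob gf by blast+
  have "Le Q f (g' \<cdot> (g \<cdot> f))"
    using adjoint_left_iff[OF assms(2,4) assms(3) gf] le_refl[OF gf] by simp
  then have "Le Q (Id Q X) (f' \<cdot> (g' \<cdot> (g \<cdot> f)))"
    using adjoint_left_iff[OF assms(1,3) iX comp_in_Hom[OF gf g']] comp_id[OF assms(3)] by simp
  then show "Le Q (Id Q X) ((f' \<cdot> g') \<cdot> (g \<cdot> f))"
    using comp_assoc[OF gf g' f'] by simp
  have "Le Q (f \<cdot> (f' \<cdot> g')) g'"
    using adjoint_left_iff[OF assms(1,3) gf' g'] le_refl[OF gf'] by simp
  then have "Le Q (g \<cdot> (f \<cdot> (f' \<cdot> g'))) (Id Q Z)"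
    using adjoint_left_iff[OF assms(2,4) comp_in_Hom[OF gf' assms(3)] iZ] comp_id[OF g'] by simp
  then show "Le Q ((g \<cdot> f) \<cdot> (f' \<cdot> g')) (Id Q Z)"
    using comp_assoc[OF gf' assms(3,4)] by simp
qed

lemma adjoint_inverse:
  assumes "f \<in> Hom Q X Y" "g \<in> Hom Q Y X" "g \<cdot> f = Id Q X" "f \<cdot> g = Id Q Y"
  shows "adjoint Q f g"
  using assms adjointI le_refl id_in_Hom Hom_Ob by metis

lemma adjoint_Id:
  assumes "X \<in> Ob Q"
  shows "adjoint Q (Id Q X) (Id Q X)"
  using adjoint_inverse id_in_Hom comp_id assms by blast

section \<open>Sieves of left adjoints\<close>

lemma Map_cat_simps [simp]:
  "Ob (Map_cat Q) = Ob Q" "Arr (Map_cat Q) = {f. \<exists>g. adjoint Q f g}" "Dom (Map_cat Q) = Dom Q"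
  "Cod (Map_cat Q) = Cod Q" "Id (Map_cat Q) = Id Q" "Comp (Map_cat Q) = Comp Q"
  by (simp_all add: Map_cat_def)

lemma Hom_Map_cat: "f \<in> Hom (Map_cat Q) X Y \<longleftrightarrow> f \<in> Hom Q X Y \<and> (\<exists>g. adjoint Q f g)"
  by (auto simp: Hom_def adjoint_def)

lemma category_Map_cat: "category (Map_cat Q)"
proof
  show "X \<in> Ob (Map_cat Q) \<Longrightarrow> Id (Map_cat Q) X \<in> Hom (Map_cat Q) X X" for X
    using id_in_Hom adjoint_Id by (auto simp: Hom_Map_cat)
  show "f \<in> Hom (Map_cat Q) X Y \<Longrightarrow> g \<in> Hom (Map_cat Q) Y Z \<Longrightarrow>
      g \<cdot>\<^bsub>Map_cat Q\<^esub> f \<in> Hom (Map_cat Q) X Z" for f g X Y Z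
    unfolding Hom_Map_cat Map_cat_simps using adjoint_comp comp_in_Hom by blast
qed (use dom_in_Ob cod_in_Ob comp_id id_comp comp_assoc in
    \<open>auto simp: adjoint_def Hom_Map_cat\<close>)

lemma sieve_HomD:
  assumes "is_sieve (Map_cat Q) X S" "s \<in> S"
  shows "s \<in> Hom Q (Dom Q s) X" "\<exists>s'. adjoint Q s s'"
  using assms by (auto simp: is_sieve_def Hom_def adjoint_def)

lemma sieve_comp:
  assumes "is_sieve (Map_cat Q) X S" "s \<in> S" "adjoint Q h h'" "h \<in> Hom Q U (Dom Q s)"
  shows "s \<cdot> h \<in> S"
  using assms by (auto simp: is_sieve_def Hom_def)

section \<open>The coreflexive arrow of a sieve\<close>

lemma sieve_Sup_set:
  assumes "is_sieve (Map_cat Q) X S"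
  shows "{s \<cdot> right_adjoint Q s | s. s \<in> S} \<subseteq> Hom Q X X"
proof clarify
  fix s assume s: "s \<in> S"
  obtain s' where s': "adjoint Q s s'" using sieve_HomD[OF assms s] by blast
  show "s \<cdot> right_adjoint Q s \<in> Hom Q X X"
    using right_adjoint_eq[OF s'] sieve_HomD[OF assms s] adjointD(1)[OF s'] comp_in_Hom by metis
qed

lemma sieve_Sup_Hom:
  assumes "is_sieve (Map_cat Q) X S" "X \<in> Ob Q"
  shows "sieve_Sup Q X S \<in> Hom Q X X"
  unfolding sieve_Sup_def using Sup_Hom sieve_Sup_set assms by blast

lemma sieve_Sup_upper:
  assumes "is_sieve (Map_cat Q) X S" "s \<in> S" "adjoint Q s s'"
  shows "Le Q (s \<cdot> s') (sieve_Sup Q X S)"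
  unfolding sieve_Sup_def
  using Sup_upper[OF sieve_Sup_set[OF assms(1)], of "s \<cdot> s'"] right_adjoint_eq[OF assms(3)] assms(2)
  by blast

text \<open>The bracketing \<open>(f \<cdot> s) \<cdot> s'\<close> is the one to which
  \<open>adjoint_right_iff\<close> applies, and an arbitrary right adjoint \<open>s'\<close> spares
  its users the description operator in \<open>right_adjoint\<close>.\<close>

lemma sieve_Sup_comp_le:
  assumes S: "is_sieve (Map_cat Q) X S" and X: "X \<in> Ob Q"
    and f: "f \<in> Hom Q X Y" and g: "g \<in> Hom Q X Y"
    and le: "\<And>s s'. s \<in> S \<Longrightarrow> adjoint Q s s' \<Longrightarrow> s \<in> Hom Q (Dom Q s) X \<Longrightarrow>
      s' \<in> Hom Q X (Dom Q s) \<Longrightarrow> Le Q ((f \<cdot> s) \<cdot> s') g"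
  shows "Le Q (f \<cdot> sieve_Sup Q X S) g"
  unfolding sieve_Sup_def
proof (rule comp_Sup_le[OF sieve_Sup_set[OF S] X f g])
  fix a assume "a \<in> {s \<cdot> right_adjoint Q s | s. s \<in> S}"
  then obtain s where s: "s \<in> S" "a = s \<cdot> right_adjoint Q s" by blast
  obtain s' where s': "adjoint Q s s'" using sieve_HomD[OF S s(1)] by blast
  note t = sieve_HomD(1)[OF S s(1)] adjointD(1)[OF s' sieve_HomD(1)[OF S s(1)]]
  show "Le Q (f \<cdot> a) g"
    using le[OF s(1) s' t] s(2) right_adjoint_eq[OF s'] comp_assoc[OF t(2,1) f] by simp
qed

lemma sieve_Sup_least:
  assumes S: "is_sieve (Map_cat Q) X S" and g: "g \<in> Hom Q X X"
    and le: "\<And>s s'. s \<in> S \<Longrightarrow> adjoint Q s s' \<Longrightarrow> s \<in> Hom Q (Dom Q s) X \<Longrightarrow>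
      s' \<in> Hom Q X (Dom Q s) \<Longrightarrow> Le Q (s \<cdot> s') g"
  shows "Le Q (sieve_Sup Q X S) g"
proof -
  have X: "X \<in> Ob Q" using Hom_Ob g by blast
  have "Le Q (Id Q X \<cdot> sieve_Sup Q X S) g"
    using sieve_Sup_comp_le[OF S X id_in_Hom[OF X] g] le id_comp by metis
  then show ?thesis using id_comp sieve_Sup_Hom[OF S X] by simp
qed

lemma sieve_Sup_le_Id:
  assumes "is_sieve (Map_cat Q) X S" "X \<in> Ob Q"
  shows "Le Q (sieve_Sup Q X S) (Id Q X)"
  using sieve_Sup_least[OF assms(1) id_in_Hom[OF assms(2)]] adjointD(3) by blast

text \<open>The other inequality is automatic, since each summand is bounded by a counit.\<close>

lemma Map_topology_iff:
  assumes "X \<in> Ob Q"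
  shows "S \<in> Map_topology Q X \<longleftrightarrow>
    is_sieve (Map_cat Q) X S \<and> Le Q (Id Q X) (sieve_Sup Q X S)"
proof -
  have "Id Q X = sieve_Sup Q X S \<longleftrightarrow> Le Q (Id Q X) (sieve_Sup Q X S)"
    if S: "is_sieve (Map_cat Q) X S"
    using le_antisym[OF id_in_Hom[OF assms] sieve_Sup_Hom[OF S assms]] sieve_Sup_le_Id[OF S assms]
      le_refl[OF id_in_Hom[OF assms]] by auto
  then show ?thesis by (auto simp: Map_topology_def)
qed

section \<open>Covers of a subcanonical topology\<close>

lemma subcanonical_sieve_Sup:
  assumes split: "coreflexives_split Q" and sub: "subcanonical (Map_cat Q) J"
    and X: "X \<in> Ob Q" and SJ: "S \<in> J X"
  shows "sieve_Sup Q X S = Id Q X"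
proof -
  define e where "e = sieve_Sup Q X S"
  have S: "is_sieve (Map_cat Q) X S"
    using sub X SJ by (auto simp: subcanonical_def grothendieck_topology_def)
  have e: "e \<in> Hom Q X X" "Le Q e (Id Q X)"
    using sieve_Sup_Hom sieve_Sup_le_Id S X by (auto simp: e_def)
  obtain E g f where E: "E \<in> Ob Q" and g: "g \<in> Hom Q E X" and f: "f \<in> Hom Q X E"
    and fg: "f \<cdot> g = Id Q E" and gf: "g \<cdot> f = e"
    using split X e unfolding coreflexives_split_def by blast
  \<comment> \<open>\<open>f \<cdot> g = 1\<close> is the unit and
    \<open>g \<cdot> f = e \<le> 1\<close> the counit. Thus \<open>g\<close> is an arrow of
    \<open>Map_cat Q\<close>, whereas \<open>f\<close> is so far only a right adjoint.\<close>
  have adj_g: "adjoint Q g f"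
    using adjointI[OF g f] le_refl[OF id_in_Hom[OF E]] fg gf e by simp
  \<comment> \<open>The summand \<open>s \<cdot> s'\<close> lies below \<open>e\<close>; transposed,
    this reads \<open>s \<le> e \<cdot> s\<close>.\<close>
  have es: "e \<cdot> s = s" if s: "s \<in> S" for s
  proof -
    obtain s' where s': "adjoint Q s s'" using sieve_HomD[OF S s] by blast
    have sH: "s \<in> Hom Q (Dom Q s) X" using sieve_HomD[OF S s] by blast
    have "Le Q (e \<cdot> s) s"
      using comp_mono_left[OF sH e(1) id_in_Hom[OF X] e(2)] id_comp[OF sH] by simp
    moreover have "Le Q s (e \<cdot> s)"
      using adjoint_right_iff[OF s' sH sH e(1)] sieve_Sup_upper[OF S s s'] e_def by simp
    ultimately show ?thesis using le_antisym comp_in_Hom[OF sH e(1)] sH by blast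
  qed
  \<comment> \<open>As \<open>f\<close> is not known to be a left adjoint, closure under composition
    does not apply. The right adjoint is \<open>s' \<cdot> g\<close>: for the unit, \<open>s'
    \<cdot> (g \<cdot> f) \<cdot> s = s' \<cdot> e \<cdot> s = s' \<cdot> s\<close>.\<close>
  have fs_map: "f \<cdot> s \<in> Hom (Map_cat Q) (Dom Q s) E" if s: "s \<in> S" for s
  proof -
    obtain s' where s': "adjoint Q s s'" using sieve_HomD[OF S s] by blast
    have sH: "s \<in> Hom Q (Dom Q s) X" using sieve_HomD[OF S s] by blast
    note s'H = adjointD[OF s' sH]
    have fs: "f \<cdot> s \<in> Hom Q (Dom Q s) E" and sg: "s' \<cdot> g \<in> Hom Q E (Dom Q s)"
      using comp_in_Hom sH f s'H g by blast+
    have "(s' \<cdot> g) \<cdot> (f \<cdot> s) = s' \<cdot> ((g \<cdot> f) \<cdot> s)"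
      using comp_assoc[OF fs g s'H(1)] comp_assoc[OF sH f g] by simp
    also have "\<dots> = s' \<cdot> s" using gf es[OF s] by simp
    finally have 1: "Le Q (Id Q (Dom Q s)) ((s' \<cdot> g) \<cdot> (f \<cdot> s))" using s'H by simp
    have "Le Q (s \<cdot> (s' \<cdot> g)) g"
      using adjoint_left_iff[OF s' sH sg g] le_refl[OF sg] by simp
    then have "Le Q (f \<cdot> (s \<cdot> (s' \<cdot> g))) (f \<cdot> g)"
      using comp_mono_right comp_in_Hom[OF sg sH] g f by blast
    then have "Le Q ((f \<cdot> s) \<cdot> (s' \<cdot> g)) (Id Q E)"
      using comp_assoc[OF sg sH f] fg by simp
    then show ?thesis using adjointI[OF fs sg 1] fs by (auto simp: Hom_Map_cat)
  qed
  have sheafE: "\<exists>!a. a \<in> Hom (Map_cat Q) X Y \<and> (\<forall>s\<in>S. a \<cdot> s = x s)"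
    if "Y \<in> Ob Q" "matching_family (Map_cat Q) (representable (Map_cat Q) Y) S x" for Y x
    using sub X SJ that unfolding subcanonical_def sheaf_def
    by (simp add: representable_def)
  have mE: "matching_family (Map_cat Q) (representable (Map_cat Q) E) S (\<lambda>s. f \<cdot> s)"
    unfolding matching_family_def representable_def
    using fs_map comp_assoc[OF _ _ f] sieve_HomD(1)[OF S] adjoint_Hom by (auto; metis)
  have mX: "matching_family (Map_cat Q) (representable (Map_cat Q) X) S (\<lambda>s. s)"
    unfolding matching_family_def representable_def
    using sieve_HomD[OF S] by (auto simp: Hom_Map_cat)
  obtain a where a: "a \<in> Hom (Map_cat Q) X E" "\<And>s. s \<in> S \<Longrightarrow> a \<cdot> s = f \<cdot> s"
    using sheafE[OF E mE] by blast
  have aH: "a \<in> Hom Q X E" using a by (simp add: Hom_Map_cat)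
  have gM: "g \<in> Hom (Map_cat Q) E X" using adj_g g by (auto simp: Hom_Map_cat)
  \<comment> \<open>Both \<open>g \<cdot> a\<close> and the identity amalgamate the family of the
    \<open>s\<close> themselves, so they coincide. Hence the monic \<open>g\<close> is invertible,
    \<open>a\<close> equals \<open>f\<close>, and \<open>e = g \<cdot> f\<close> is the
    identity.\<close>
  have "g \<cdot> a \<in> Hom (Map_cat Q) X X"
    using category.comp_in_Hom[OF category_Map_cat a(1) gM] by simp
  moreover have "\<forall>s\<in>S. (g \<cdot> a) \<cdot> s = s"
    using comp_assoc[OF sieve_HomD(1)[OF S] aH g] comp_assoc[OF sieve_HomD(1)[OF S] f g] a(2) gf es
    by simp
  moreover have "Id Q X \<in> Hom (Map_cat Q) X X"
    using category.id_in_Hom[OF category_Map_cat] X by simp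
  moreover have "\<forall>s\<in>S. Id Q X \<cdot> s = s"
    using id_comp sieve_HomD(1)[OF S] by blast
  ultimately have ga: "g \<cdot> a = Id Q X" using sheafE[OF X mX] by blast
  have "f = f \<cdot> (g \<cdot> a)" using ga comp_id[OF f] by simp
  also have "\<dots> = a" using comp_assoc[OF aH g f] fg id_comp[OF aH] by simp
  finally show ?thesis using ga gf e_def by simp
qed

end

lemma (in category) presheaf_representable: "presheaf C (representable C Y)"
  using comp_in_Hom comp_id comp_assoc unfolding presheaf_def representable_def
  by (auto simp: Hom_def)

section \<open>The topology on the left adjoints of a tabular quantaloid\<close>

text \<open>The last two properties are stated as tests against an arrow \<open>r\<close> instead of
  as equations between suprema, which is the form that transfers easily. In
  \<open>local_selection\<close> the family \<open>P\<close> consists of pairs because the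
  conclusion about \<open>h\<close> refers to the factor \<open>p\<close>, which the composite
  \<open>q \<cdot> p\<close> does not determine.\<close>

locale tabular_quantaloid = quantaloid +
  assumes map_discrete:
      "adjoint Q f f' \<Longrightarrow> adjoint Q g g' \<Longrightarrow> f \<in> Hom Q X Y \<Longrightarrow> g \<in> Hom Q X Y \<Longrightarrow> Le Q f g \<Longrightarrow> f = g"
    and weakly_tabular: "q \<in> Hom Q X Y \<Longrightarrow> r \<in> Hom Q X Y \<Longrightarrow>
      (\<And>U f f' g g'. adjoint Q f f' \<Longrightarrow> adjoint Q g g' \<Longrightarrow> f \<in> Hom Q U Y \<Longrightarrow> g \<in> Hom Q U X \<Longrightarrow>
        Le Q (f \<cdot> g') q \<Longrightarrow> Le Q (f \<cdot> g') r) \<Longrightarrow> Le Q q r"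
    and local_selection: "r \<in> Hom Q Y Y \<Longrightarrow>
      (\<And>q p. (q, p) \<in> P \<Longrightarrow> \<exists>Z. p \<in> Hom Q Y Z \<and> q \<in> Hom Q Z Y) \<Longrightarrow>
      Le Q (Id Q Y) (\<Squnion>\<^bsub>hom_order Q Y Y\<^esub> {q \<cdot> p | q p. (q, p) \<in> P}) \<Longrightarrow>
      (\<And>U h h' k k' q p. (q, p) \<in> P \<Longrightarrow> adjoint Q h h' \<Longrightarrow> adjoint Q k k' \<Longrightarrow> h \<in> Hom Q U Y \<Longrightarrow>
        k \<in> Hom Q U (Cod Q p) \<Longrightarrow> Le Q (k \<cdot> h') p \<Longrightarrow> Le Q (h \<cdot> h') r) \<Longrightarrow>
      Le Q (Id Q Y) r"
begin

text \<open>Inserting the cover in the middle of \<open>f' \<cdot> f\<close> bounds the identity of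
  \<open>Y\<close> by the supremum of the \<open>(f' \<cdot> s) \<cdot> (s' \<cdot> f)\<close>. No
  pullback of \<open>s\<close> along \<open>f\<close> is at hand; \<open>local_selection\<close>
  provides instead enough arrows \<open>h\<close> for which \<open>f \<cdot> h\<close> factors
  through some \<open>s\<close>.\<close>

lemma Map_topology_stable:
  assumes X: "X \<in> Ob Q" and SJ: "S \<in> Map_topology Q X"
    and a: "adjoint Q f f'" and f: "f \<in> Hom Q Y X"
  shows "sieve_pullback (Map_cat Q) f S \<in> Map_topology Q Y"
proof -
  define R where "R = sieve_pullback (Map_cat Q) f S"
  define P where "P = {(f' \<cdot> s, s' \<cdot> f) | s s'. s \<in> S \<and> adjoint Q s s'}"
  have Y: "Y \<in> Ob Q" using Hom_Ob f by blast
  have S: "is_sieve (Map_cat Q) X S" using SJ X by (simp add: Map_topology_iff)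
  note sS = sieve_HomD(1)[OF S]
  note f' = adjointD[OF a f]
  have R_iff: "h \<in> R \<longleftrightarrow> (\<exists>h'. adjoint Q h h') \<and> h \<in> Hom Q (Dom Q h) Y \<and> f \<cdot> h \<in> S" for h
    using f by (auto simp: R_def sieve_pullback_def Hom_def adjoint_def)
  have R: "is_sieve (Map_cat Q) Y R"
    unfolding is_sieve_def
  proof (intro conjI ballI impI subsetI)
    show "x \<in> R \<Longrightarrow> x \<in> {s \<in> Arr (Map_cat Q). Cod (Map_cat Q) s = Y}" for x
      by (auto simp: R_iff Hom_def)
  next
    fix s h assume s: "s \<in> R" and h: "h \<in> Arr (Map_cat Q)" and
      c: "Cod (Map_cat Q) h = Dom (Map_cat Q) s"
    obtain s' where s': "adjoint Q s s'" and sH: "s \<in> Hom Q (Dom Q s) Y" and fs: "f \<cdot> s \<in> S"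
      using s R_iff by blast
    obtain h' where h': "adjoint Q h h'" using h by auto
    have hH: "h \<in> Hom Q (Dom Q h) (Dom Q s)" using adjoint_Hom[OF h'] c by simp
    have "h \<in> Hom Q (Dom Q h) (Dom Q (f \<cdot> s))"
      using HomD(2)[OF comp_in_Hom[OF sH f]] hH by simp
    then have "(f \<cdot> s) \<cdot> h \<in> S" using sieve_comp[OF S fs h'] by blast
    moreover have "s \<cdot> h \<in> Hom Q (Dom Q h) Y" using comp_in_Hom hH sH by blast
    ultimately show "s \<cdot>\<^bsub>Map_cat Q\<^esub> h \<in> R"
      using adjoint_comp[OF h' s' hH sH] comp_assoc[OF hH sH f] by (auto simp: R_iff Hom_def)
  qed
  have PH: "\<exists>Z. p \<in> Hom Q Y Z \<and> q \<in> Hom Q Z Y" if qp: "(q, p) \<in> P" for q p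
  proof -
    obtain s s' where s: "s \<in> S" "adjoint Q s s'" "q = f' \<cdot> s" "p = s' \<cdot> f"
      using qp unfolding P_def by blast
    show ?thesis
      using s(3,4) comp_in_Hom[OF f adjointD(1)[OF s(2) sS[OF s(1)]]]
        comp_in_Hom[OF sS[OF s(1)] f'(1)] by blast
  qed
  have PS: "{q \<cdot> p | q p. (q, p) \<in> P} \<subseteq> Hom Q Y Y" using PH comp_in_Hom by blast
  define Z where "Z = \<Squnion>\<^bsub>hom_order Q Y Y\<^esub> {q \<cdot> p | q p. (q, p) \<in> P}"
  have Z: "Z \<in> Hom Q Y Y" using Sup_Hom[OF Y Y PS] by (simp add: Z_def)
  have "Le Q ((f' \<cdot> sieve_Sup Q X S) \<cdot> f) Z"
    unfolding sieve_Sup_def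
  proof (rule comp_Sup_comp_le[OF sieve_Sup_set[OF S] X f f'(1) Z])
    fix b assume "b \<in> {s \<cdot> right_adjoint Q s | s. s \<in> S}"
    then obtain s where s: "s \<in> S" "b = s \<cdot> right_adjoint Q s" by blast
    obtain s' where s': "adjoint Q s s'" using sieve_HomD[OF S s(1)] by blast
    have b: "b = s \<cdot> s'" using s right_adjoint_eq[OF s'] by simp
    note s'H = adjointD(1)[OF s' sS[OF s(1)]]
    have "(f' \<cdot> b) \<cdot> f = (f' \<cdot> s) \<cdot> (s' \<cdot> f)"
      using comp_assoc[OF s'H sS[OF s(1)] f'(1)]
        comp_assoc[OF f s'H comp_in_Hom[OF sS[OF s(1)] f'(1)]] b by simp
    also have "\<dots> \<in> {q \<cdot> p | q p. (q, p) \<in> P}" using s s' by (auto simp: P_def)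
    finally show "Le Q ((f' \<cdot> b) \<cdot> f) Z" unfolding Z_def using Sup_upper[OF PS] by blast
  qed
  moreover have "sieve_Sup Q X S = Id Q X" using SJ by (simp add: Map_topology_def)
  ultimately have "Le Q (f' \<cdot> f) Z" using comp_id[OF f'(1)] by simp
  then have "Le Q (Id Q Y) Z"
    using le_trans[OF id_in_Hom[OF Y] comp_in_Hom[OF f f'(1)] Z] f'(2) by blast
  moreover note sieve_Sup_Hom[OF R Y]
  ultimately have "Le Q (Id Q Y) (sieve_Sup Q Y R)"
    unfolding Z_def
  proof (intro local_selection[of "sieve_Sup Q Y R" Y P] PH)
    fix U h h' k k' q p
    assume qp: "(q, p) \<in> P" and h': "adjoint Q h h'" and k': "adjoint Q k k'"
      and h: "h \<in> Hom Q U Y" and k: "k \<in> Hom Q U (Cod Q p)" and le: "Le Q (k \<cdot> h') p"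
    obtain s s' where s: "s \<in> S" and s': "adjoint Q s s'" and p: "p = s' \<cdot> f"
      using qp by (auto simp: P_def)
    note s'H = adjointD(1)[OF s' sS[OF s]]
    have pH: "p \<in> Hom Q Y (Dom Q s)" using comp_in_Hom[OF f s'H] p by simp
    have kH: "k \<in> Hom Q U (Dom Q s)" using k HomD(3)[OF pH] by simp
    have fh: "f \<cdot> h \<in> Hom Q U X" and sk: "s \<cdot> k \<in> Hom Q U X"
      using comp_in_Hom h f kH sS[OF s] by blast+
    \<comment> \<open>Transposing \<open>k \<cdot> h' \<le> s' \<cdot> f\<close> along
      \<open>h\<close> and then along \<open>s\<close> gives
      \<open>s \<cdot> k \<le> f \<cdot> h\<close>. Both sides are left adjoints, hence equal, and
      \<open>f \<cdot> h\<close> lies in \<open>S\<close> because \<open>s\<close> does.\<close>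
    have "Le Q k (s' \<cdot> (f \<cdot> h))"
      using adjoint_right_iff[OF h' h kH pH] le p comp_assoc[OF h f s'H] by simp
    then have "Le Q (s \<cdot> k) (f \<cdot> h)" using adjoint_left_iff[OF s' sS[OF s] kH fh] by simp
    then have "s \<cdot> k = f \<cdot> h"
      using map_discrete[OF adjoint_comp[OF k' s' kH sS[OF s]] adjoint_comp[OF h' a h f] sk fh]
      by simp
    then have "h \<in> R" using sieve_comp[OF S s k' kH] h h' by (auto simp: R_iff Hom_def)
    then show "Le Q (h \<cdot> h') (sieve_Sup Q Y R)" using sieve_Sup_upper[OF R _ h'] by blast
  qed
  then show ?thesis using R Y by (simp add: Map_topology_iff R_def)
qed

text \<open>For \<open>s\<close> in \<open>S\<close> the identity of its domain is a supremum of
  \<open>h \<cdot> h'\<close> with \<open>s \<cdot> h\<close> in \<open>R\<close>. Composing with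
  \<open>s\<close> gives \<open>s \<le> sieve_Sup Q X R \<cdot> s\<close>, whose transpose bounds
  \<open>s \<cdot> s'\<close>.\<close>

lemma Map_topology_transitive:
  assumes X: "X \<in> Ob Q" and SJ: "S \<in> Map_topology Q X" and R: "is_sieve (Map_cat Q) X R"
    and pull: "\<And>s. s \<in> S \<Longrightarrow> sieve_pullback (Map_cat Q) s R \<in> Map_topology Q (Dom Q s)"
  shows "R \<in> Map_topology Q X"
proof -
  have S: "is_sieve (Map_cat Q) X S" using SJ X by (simp add: Map_topology_iff)
  note RH = sieve_Sup_Hom[OF R X]
  have "Le Q (sieve_Sup Q X S) (sieve_Sup Q X R)"
  proof (rule sieve_Sup_least[OF S RH])
    fix s s' assume s: "s \<in> S" and s': "adjoint Q s s'" and sH: "s \<in> Hom Q (Dom Q s) X"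
      and s'H: "s' \<in> Hom Q X (Dom Q s)"
    define T where "T = sieve_pullback (Map_cat Q) s R"
    have D: "Dom Q s \<in> Ob Q" using Hom_Ob sH by blast
    have T: "is_sieve (Map_cat Q) (Dom Q s) T" and TI: "Id Q (Dom Q s) = sieve_Sup Q (Dom Q s) T"
      using pull[OF s] by (auto simp: Map_topology_def T_def)
    have Rs: "sieve_Sup Q X R \<cdot> s \<in> Hom Q (Dom Q s) X" using comp_in_Hom sH RH by blast
    have "Le Q (s \<cdot> sieve_Sup Q (Dom Q s) T) (sieve_Sup Q X R \<cdot> s)"
    proof (rule sieve_Sup_comp_le[OF T D sH Rs])
      fix h h' assume h: "h \<in> T" and h': "adjoint Q h h'" and hH: "h \<in> Hom Q (Dom Q h) (Dom Q s)"
        and h'H: "h' \<in> Hom Q (Dom Q s) (Dom Q h)"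
      have "s \<cdot> h \<in> R" using h by (simp add: T_def sieve_pullback_def)
      \<comment> \<open>This is the summand of \<open>R\<close> at \<open>s \<cdot> h\<close>, whose
        right adjoint is \<open>h' \<cdot> s'\<close>.\<close>
      then have "Le Q ((s \<cdot> h) \<cdot> (h' \<cdot> s')) (sieve_Sup Q X R)"
        using sieve_Sup_upper[OF R _ adjoint_comp[OF h' s' hH sH]] by blast
      then have "Le Q (((s \<cdot> h) \<cdot> h') \<cdot> s') (sieve_Sup Q X R)"
        using comp_assoc[OF s'H h'H comp_in_Hom[OF hH sH]] by simp
      then show "Le Q ((s \<cdot> h) \<cdot> h') (sieve_Sup Q X R \<cdot> s)"
        using adjoint_right_iff[OF s' sH comp_in_Hom[OF h'H comp_in_Hom[OF hH sH]] RH] by simp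
    qed
    then have "Le Q s (sieve_Sup Q X R \<cdot> s)" using TI comp_id[OF sH] by simp
    then show "Le Q (s \<cdot> s') (sieve_Sup Q X R)"
      using adjoint_right_iff[OF s' sH sH RH] by simp
  qed
  moreover have "sieve_Sup Q X S = Id Q X" using SJ by (simp add: Map_topology_def)
  ultimately show ?thesis using R X by (simp add: Map_topology_iff)
qed

lemma grothendieck_topology_Map: "grothendieck_topology (Map_cat Q) (Map_topology Q)"
  unfolding grothendieck_topology_def
proof (intro conjI ballI allI impI)
  show "X \<in> Ob (Map_cat Q) \<Longrightarrow> S \<in> Map_topology Q X \<Longrightarrow> is_sieve (Map_cat Q) X S" for X S
    by (simp add: Map_topology_def)
next
  fix X assume "X \<in> Ob (Map_cat Q)"
  then have X: "X \<in> Ob Q" by simp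
  define S where "S = {s \<in> Arr (Map_cat Q). Cod (Map_cat Q) s = X}"
  have S: "is_sieve (Map_cat Q) X S"
    unfolding is_sieve_def
  proof (intro conjI ballI impI)
    fix s h assume s: "s \<in> S" and h: "h \<in> Arr (Map_cat Q)"
      and c: "Cod (Map_cat Q) h = Dom (Map_cat Q) s"
    have "s \<in> Hom (Map_cat Q) (Dom Q s) X" "h \<in> Hom (Map_cat Q) (Dom Q h) (Dom Q s)"
      using s h c by (auto simp: S_def Hom_def)
    then have "s \<cdot>\<^bsub>Map_cat Q\<^esub> h \<in> Hom (Map_cat Q) (Dom Q h) X"
      using category.comp_in_Hom[OF category_Map_cat] by blast
    then show "s \<cdot>\<^bsub>Map_cat Q\<^esub> h \<in> S" unfolding S_def Hom_def by blast
  qed (simp add: S_def)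
  \<comment> \<open>The summand of the identity alone is already the identity.\<close>
  have "Id Q X \<in> S" using adjoint_Id[OF X] HomD[OF id_in_Hom[OF X]] by (auto simp: S_def)
  then have "Le Q (Id Q X) (sieve_Sup Q X S)"
    using sieve_Sup_upper[OF S _ adjoint_Id[OF X]] comp_id[OF id_in_Hom[OF X]] by simp
  then show "{s \<in> Arr (Map_cat Q). Cod (Map_cat Q) s = X} \<in> Map_topology Q X"
    using S X by (simp only: Map_topology_iff S_def)
next
  fix X S f
  assume "X \<in> Ob (Map_cat Q)" "S \<in> Map_topology Q X" "f \<in> Arr (Map_cat Q)" "Cod (Map_cat Q) f = X"
  then show "sieve_pullback (Map_cat Q) f S \<in> Map_topology Q (Dom (Map_cat Q) f)"
    using Map_topology_stable adjoint_Hom by auto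
next
  fix X S R
  assume "X \<in> Ob (Map_cat Q)" "S \<in> Map_topology Q X" "is_sieve (Map_cat Q) X R"
    "\<forall>s\<in>S. sieve_pullback (Map_cat Q) s R \<in> Map_topology Q (Dom (Map_cat Q) s)"
  then show "R \<in> Map_topology Q X" using Map_topology_transitive by simp
qed

text \<open>The amalgamation of a matching family \<open>x\<close> is \<open>\<Or> x s \<cdot> s\<^sup>*\<close>, with right adjoint
  \<open>\<Or> s \<cdot> (x s)\<^sup>*\<close>.\<close>

lemma Map_topology_amalgamation:
  assumes X: "X \<in> Ob Q" and Y: "Y \<in> Ob Q" and SJ: "S \<in> Map_topology Q X"
    and xH: "\<And>s. s \<in> S \<Longrightarrow> x s \<in> Hom Q (Dom Q s) Y"
    and x_map: "\<And>s. s \<in> S \<Longrightarrow> \<exists>y. adjoint Q (x s) y"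
    and match: "\<And>s h h'. s \<in> S \<Longrightarrow> adjoint Q h h' \<Longrightarrow> Cod Q h = Dom Q s \<Longrightarrow> x (s \<cdot> h) = x s \<cdot> h"
  shows "\<exists>!a. a \<in> Hom (Map_cat Q) X Y \<and> (\<forall>s\<in>S. a \<cdot> s = x s)"
proof -
  have S: "is_sieve (Map_cat Q) X S" and SI: "sieve_Sup Q X S = Id Q X"
    using SJ by (simp_all add: Map_topology_def)
  note sS = sieve_HomD(1)[OF S]
  define rs where "rs = right_adjoint Q"
  define rx where "rx = (\<lambda>s. right_adjoint Q (x s))"
  have rs: "adjoint Q s (rs s)" if "s \<in> S" for s
    using sieve_HomD(2)[OF S that] right_adjoint_eq by (auto simp: rs_def)
  have rx: "adjoint Q (x s) (rx s)" if "s \<in> S" for s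
    using x_map[OF that] right_adjoint_eq by (auto simp: rx_def)
  note rsH = adjointD(1)[OF rs sS] and rxH = adjointD(1)[OF rx xH]
  define A where "A = {x s \<cdot> rs s | s. s \<in> S}"
  define B where "B = {s \<cdot> rx s | s. s \<in> S}"
  have AS: "A \<subseteq> Hom Q X Y" using comp_in_Hom[OF rsH xH] by (auto simp: A_def)
  have BS: "B \<subseteq> Hom Q Y X" using comp_in_Hom[OF rxH sS] by (auto simp: B_def)
  define a where "a = \<Squnion>\<^bsub>hom_order Q X Y\<^esub> A"
  define b where "b = \<Squnion>\<^bsub>hom_order Q Y X\<^esub> B"
  have aH: "a \<in> Hom Q X Y" and bH: "b \<in> Hom Q Y X"
    using Sup_Hom X Y AS BS by (auto simp: a_def b_def)
  have a_up: "Le Q (x s \<cdot> rs s) a" and b_up: "Le Q (s \<cdot> rx s) b" if "s \<in> S" for s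
    using Sup_upper[OF AS] Sup_upper[OF BS] that by (auto simp: a_def b_def A_def B_def)
  \<comment> \<open>Chain \<open>s \<le> b \<cdot> x s\<close> with
    \<open>x s \<le> a \<cdot> s\<close>, both transposes of the summands at \<open>s\<close>, and
    take the supremum over the cover.\<close>
  have unit: "Le Q (Id Q X) (b \<cdot> a)"
  proof -
    have "Le Q (s \<cdot> rs s) (b \<cdot> a)" if s: "s \<in> S" for s
    proof -
      have xa: "Le Q (x s) (a \<cdot> s)"
        using adjoint_right_iff[OF rs[OF s] sS[OF s] xH[OF s] aH] a_up[OF s] by simp
      have sb: "Le Q s (b \<cdot> x s)"
        using adjoint_right_iff[OF rx[OF s] xH[OF s] sS[OF s] bH] b_up[OF s] by simp
      have as: "a \<cdot> s \<in> Hom Q (Dom Q s) Y" using comp_in_Hom sS[OF s] aH by blast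
      have "Le Q s (b \<cdot> (a \<cdot> s))"
        using le_trans[OF sS[OF s] comp_in_Hom[OF xH[OF s] bH] comp_in_Hom[OF as bH] sb]
          comp_mono_right[OF xH[OF s] as bH xa] by blast
      then show ?thesis
        using adjoint_right_iff[OF rs[OF s] sS[OF s] sS[OF s] comp_in_Hom[OF aH bH]]
          comp_assoc[OF sS[OF s] aH bH] by simp
    qed
    then have "Le Q (sieve_Sup Q X S) (b \<cdot> a)"
      using sieve_Sup_least[OF S comp_in_Hom[OF aH bH]] right_adjoint_eq unfolding rs_def by metis
    then show ?thesis using SI by simp
  qed
  have counit: "Le Q (a \<cdot> b) (Id Q Y)"
    unfolding a_def
  proof (rule Sup_comp_le[OF AS Y bH id_in_Hom[OF Y]])
    fix c assume c: "c \<in> A"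
    have cH: "c \<in> Hom Q X Y" using c AS by blast
    obtain s where s: "s \<in> S" "c = x s \<cdot> rs s" using c by (auto simp: A_def)
    show "Le Q (c \<cdot> b) (Id Q Y)"
      unfolding b_def
    proof (rule comp_Sup_le[OF BS Y cH id_in_Hom[OF Y]])
      fix d assume "d \<in> B"
      then obtain t where t: "t \<in> S" "d = t \<cdot> rx t" by (auto simp: B_def)
      have st: "rs s \<cdot> t \<in> Hom Q (Dom Q t) (Dom Q s)"
        using comp_in_Hom[OF sS[OF t(1)] rsH[OF s(1) s(1)]] by blast
      have xx: "rx s \<cdot> x t \<in> Hom Q (Dom Q t) (Dom Q s)"
        using comp_in_Hom[OF xH[OF t(1)] rxH[OF s(1) s(1)]] by blast
      \<comment> \<open>The heart of the counit. Transposed along \<open>x s\<close> and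
        \<open>x t\<close>, it bounds the product of the summand of \<open>a\<close> at
        \<open>s\<close> and the summand of \<open>b\<close> at \<open>t\<close> by the identity. It
        says that whatever \<open>s\<close> and \<open>t\<close> have in common is also common to
        \<open>x s\<close> and \<open>x t\<close>, which is tested on pairs of left
        adjoints.\<close>
      have "Le Q (rs s \<cdot> t) (rx s \<cdot> x t)"
      proof (rule weakly_tabular[OF st xx])
        fix U f f' g g'
        assume f': "adjoint Q f f'" and g': "adjoint Q g g'" and f: "f \<in> Hom Q U (Dom Q s)"
          and g: "g \<in> Hom Q U (Dom Q t)" and le: "Le Q (f \<cdot> g') (rs s \<cdot> t)"
        note g'H = adjointD(1)[OF g' g]
        have sf: "s \<cdot> f \<in> Hom Q U X" and tg: "t \<cdot> g \<in> Hom Q U X" and xf: "x s \<cdot> f \<in> Hom Q U Y"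
          using comp_in_Hom[OF f sS[OF s(1)]] comp_in_Hom[OF g sS[OF t(1)]]
            comp_in_Hom[OF f xH[OF s(1)]] by simp_all
        have "Le Q ((s \<cdot> f) \<cdot> g') t"
          using adjoint_left_iff[OF rs[OF s(1)] sS[OF s(1)] comp_in_Hom[OF g'H f] sS[OF t(1)]] le
            comp_assoc[OF g'H f sS[OF s(1)]] by simp
        then have "Le Q (s \<cdot> f) (t \<cdot> g)"
          using adjoint_right_iff[OF g' g sf sS[OF t(1)]] by simp
        \<comment> \<open>The compatibility of a matching family can be applied only to an equality,
          hence the appeal to \<open>map_discrete\<close>.\<close>
        then have "s \<cdot> f = t \<cdot> g"
          using map_discrete[OF adjoint_comp[OF f' rs[OF s(1)] f sS[OF s(1)]]
              adjoint_comp[OF g' rs[OF t(1)] g sS[OF t(1)]] sf tg] by simp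
        then have "x s \<cdot> f = x t \<cdot> g"
          using match[OF s(1) f' HomD(3)[OF f]] match[OF t(1) g' HomD(3)[OF g]] by simp
        then have "Le Q ((x s \<cdot> f) \<cdot> g') (x t)"
          using adjoint_right_iff[OF g' g xf xH[OF t(1)]] le_refl[OF xf] by simp
        then show "Le Q (f \<cdot> g') (rx s \<cdot> x t)"
          using adjoint_left_iff[OF rx[OF s(1)] xH[OF s(1)] comp_in_Hom[OF g'H f] xH[OF t(1)]]
            comp_assoc[OF g'H f xH[OF s(1)]] by simp
      qed
      then have "Le Q (x s \<cdot> (rs s \<cdot> t)) (x t)"
        using adjoint_left_iff[OF rx[OF s(1)] xH[OF s(1)] st xH[OF t(1)]] by simp
      then have "Le Q (c \<cdot> t) (Id Q Y \<cdot> x t)"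
        using s(2) comp_assoc[OF sS[OF t(1)] rsH[OF s(1) s(1)] xH[OF s(1)]] id_comp[OF xH[OF t(1)]]
        by simp
      then have "Le Q ((c \<cdot> t) \<cdot> rx t) (Id Q Y)"
        using adjoint_right_iff[OF rx[OF t(1)] xH[OF t(1)] comp_in_Hom[OF sS[OF t(1)] cH]
            id_in_Hom[OF Y]] by simp
      then show "Le Q (c \<cdot> d) (Id Q Y)"
        using t(2) comp_assoc[OF rxH[OF t(1) t(1)] sS[OF t(1)] cH] by simp
    qed
  qed
  have ab: "adjoint Q a b" using adjointI[OF aH bH unit counit] .
  have at: "a \<cdot> s = x s" if s: "s \<in> S" for s
  proof -
    \<comment> \<open>One inequality suffices, since both sides are left adjoints.\<close>
    have "Le Q (x s) (a \<cdot> s)"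
      using adjoint_right_iff[OF rs[OF s] sS[OF s] xH[OF s] aH] a_up[OF s] by simp
    then show ?thesis
      using map_discrete[OF rx[OF s] adjoint_comp[OF rs[OF s] ab sS[OF s] aH] xH[OF s]
          comp_in_Hom[OF sS[OF s] aH]] by simp
  qed
  have unique: "a' = a" if a': "adjoint Q a' b'" "a' \<in> Hom Q X Y" "\<And>s. s \<in> S \<Longrightarrow> a' \<cdot> s = x s"
    for a' b'
  proof -
    \<comment> \<open>The left side is \<open>a'\<close> itself, and its summands
      \<open>a' \<cdot> s \<cdot> s'\<close> are those of \<open>a\<close>. Discreteness then
      upgrades the inequality.\<close>
    have "Le Q (a' \<cdot> sieve_Sup Q X S) a"
    proof (rule sieve_Sup_comp_le[OF S X a'(2) aH])
      show "Le Q ((a' \<cdot> s) \<cdot> s') a" if "s \<in> S" "adjoint Q s s'" for s s'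
        using a'(3)[OF that(1)] a_up[OF that(1)] right_adjoint_eq[OF that(2)] by (simp add: rs_def)
    qed
    then show ?thesis
      using SI comp_id[OF a'(2)] map_discrete[OF a'(1) ab a'(2) aH] by simp
  qed
  show ?thesis
  proof (rule ex1I[of _ a])
    show "a \<in> Hom (Map_cat Q) X Y \<and> (\<forall>s\<in>S. a \<cdot> s = x s)"
      using aH ab at by (auto simp: Hom_Map_cat)
    show "a' \<in> Hom (Map_cat Q) X Y \<and> (\<forall>s\<in>S. a' \<cdot> s = x s) \<Longrightarrow> a' = a" for a'
      using unique by (auto simp: Hom_Map_cat)
  qed
qed

lemma subcanonical_Map_topology: "subcanonical (Map_cat Q) (Map_topology Q)"
  unfolding subcanonical_def sheaf_def
proof (intro conjI ballI allI impI grothendieck_topology_Map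
    category.presheaf_representable category_Map_cat)
  fix Y X S x
  assume Y: "Y \<in> Ob (Map_cat Q)" and X: "X \<in> Ob (Map_cat Q)" and S: "S \<in> Map_topology Q X"
    and "matching_family (Map_cat Q) (representable (Map_cat Q) Y) S x"
  then have x: "x s \<in> Hom (Map_cat Q) (Dom Q s) Y"
    and "adjoint Q h h' \<Longrightarrow> Cod Q h = Dom Q s \<Longrightarrow> x (s \<cdot> h) = x s \<cdot> h" if "s \<in> S" for s h h'
    using that by (auto simp: matching_family_def representable_def)
  then show "\<exists>!a. a \<in> Sec (representable (Map_cat Q) Y) X \<and>
      (\<forall>s\<in>S. Res (representable (Map_cat Q) Y) s a = x s)"
    using Map_topology_amalgamation[of X Y S x] X Y S
    by (simp add: representable_def Hom_Map_cat)
qed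

lemma canonical_Map_topology:
  assumes "coreflexives_split Q"
  shows "canonical_topology (Map_cat Q) (Map_topology Q)"
  unfolding canonical_topology_def
proof (intro conjI allI impI ballI subsetI subcanonical_Map_topology)
  fix J' X S
  assume J': "subcanonical (Map_cat Q) J'" and X: "X \<in> Ob (Map_cat Q)" and S: "S \<in> J' X"
  have "is_sieve (Map_cat Q) X S"
    using J' X S by (auto simp: subcanonical_def grothendieck_topology_def)
  then show "S \<in> Map_topology Q X"
    using subcanonical_sieve_Sup[OF assms J' _ S] X by (simp add: Map_topology_def)
qed

end

section \<open>Composition of closed cribles\<close>

locale site = category C for C :: "('c, 'a, 'z) cat_scheme" (structure) +
  fixes J :: "'c \<Rightarrow> 'a set set"
  assumes topology: "grothendieck_topology C J"
begin

abbreviation K :: "('c, 'c \<times> 'c \<times> ('a \<times> 'a) set) qtld" where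
  "K \<equiv> closed_cribles C J"

abbreviation crib :: "'c \<times> 'c \<times> ('a \<times> 'a) set \<Rightarrow> ('a \<times> 'a) set" where
  "crib p \<equiv> snd (snd p)"

section \<open>Covering sieves\<close>

lemma J_sieve: "X \<in> Ob C \<Longrightarrow> S \<in> J X \<Longrightarrow> is_sieve C X S"
  using topology by (simp add: grothendieck_topology_def)

lemma J_Hom: "X \<in> Ob C \<Longrightarrow> S \<in> J X \<Longrightarrow> s \<in> S \<Longrightarrow> s \<in> Hom C (Dom C s) X"
  using J_sieve by (auto simp: is_sieve_def Hom_def)

lemma J_top: "X \<in> Ob C \<Longrightarrow> {s \<in> Arr C. Cod C s = X} \<in> J X"
  using topology by (simp add: grothendieck_topology_def)

lemma J_pullback:
  assumes "f \<in> Hom C U X" "S \<in> J X"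
  shows "sieve_pullback C f S \<in> J U"
proof -
  have "\<forall>X \<in> Ob C. \<forall>S \<in> J X. \<forall>f \<in> Arr C. Cod C f = X \<longrightarrow> sieve_pullback C f S \<in> J (Dom C f)"
    using topology unfolding grothendieck_topology_def by (elim conjE)
  then show ?thesis using assms Hom_Ob[OF assms(1)] HomD[OF assms(1)] by blast
qed

lemma J_trans:
  assumes "X \<in> Ob C" "S \<in> J X" "is_sieve C X R" "\<And>s. s \<in> S \<Longrightarrow> sieve_pullback C s R \<in> J (Dom C s)"
  shows "R \<in> J X"
proof -
  have "\<forall>X \<in> Ob C. \<forall>S \<in> J X. \<forall>R. is_sieve C X R \<longrightarrow>
      (\<forall>s \<in> S. sieve_pullback C s R \<in> J (Dom C s)) \<longrightarrow> R \<in> J X"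
    using topology unfolding grothendieck_topology_def by (elim conjE)
  then show ?thesis using assms by blast
qed

text \<open>Pulled back along a member of \<open>S\<close>, the larger sieve becomes
  maximal.\<close>

lemma J_superset:
  assumes X: "X \<in> Ob C" and S: "S \<in> J X" and R: "is_sieve C X R" and sub: "S \<subseteq> R"
  shows "R \<in> J X"
proof (rule J_trans[OF X S R])
  fix s assume s: "s \<in> S"
  have "sieve_pullback C s R = {h \<in> Arr C. Cod C h = Dom C s}"
    using R s sub by (auto simp: sieve_pullback_def is_sieve_def)
  then show "sieve_pullback C s R \<in> J (Dom C s)"
    using J_top Hom_Ob(1)[OF J_Hom[OF X S s]] by simp
qed

text \<open>Pulled back along a member of \<open>S\<close>, the intersection is the pullback of
  \<open>T\<close>. This lets two statements that hold locally be used on one common cover.\<close>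

lemma J_Int:
  assumes X: "X \<in> Ob C" and S: "S \<in> J X" and T: "T \<in> J X"
  shows "S \<inter> T \<in> J X"
proof (rule J_trans[OF X S])
  show "is_sieve C X (S \<inter> T)"
    using J_sieve[OF X S] J_sieve[OF X T] by (auto simp: is_sieve_def)
  fix s assume s: "s \<in> S"
  have "sieve_pullback C s (S \<inter> T) = sieve_pullback C s T"
    using J_sieve[OF X S] s by (auto simp: sieve_pullback_def is_sieve_def)
  then show "sieve_pullback C s (S \<inter> T) \<in> J (Dom C s)"
    using J_pullback[OF J_Hom[OF X S s] T] by simp
qed

section \<open>Cribles and their closure\<close>

lemma spans_iff: "(f, g) \<in> spans C X Y \<longleftrightarrow> (\<exists>U. f \<in> Hom C U Y \<and> g \<in> Hom C U X)"
  using Hom_Ob by (auto simp: spans_def)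

lemma closure_iff:
  assumes "f \<in> Hom C U Y" "g \<in> Hom C U X"
  shows "(f, g) \<in> crible_closure C J X Y R \<longleftrightarrow> (\<exists>S \<in> J U. \<forall>s \<in> S. (f \<cdot> s, g \<cdot> s) \<in> R)"
  using assms HomD(2)[OF assms(1)] by (auto simp: crible_closure_def spans_iff)

lemma closure_spans: "crible_closure C J X Y R \<subseteq> spans C X Y"
  by (auto simp: crible_closure_def)

lemma cribleI:
  assumes "R \<subseteq> spans C X Y"
    and "\<And>f g h U V. (f, g) \<in> R \<Longrightarrow> f \<in> Hom C U Y \<Longrightarrow> g \<in> Hom C U X \<Longrightarrow> h \<in> Hom C V U \<Longrightarrow>
      (f \<cdot> h, g \<cdot> h) \<in> R"
  shows "crible C X Y R"
  unfolding crible_def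
proof (intro conjI assms(1) ballI, clarify)
  fix f g h assume fg: "(f, g) \<in> R" and h: "h \<in> Arr C" "Cod C h = Dom C f"
  obtain U where U: "f \<in> Hom C U Y" "g \<in> Hom C U X" using fg assms(1) spans_iff by blast
  then have "h \<in> Hom C (Dom C h) U" using h by (simp add: Hom_def)
  then show "(f \<cdot> h, g \<cdot> h) \<in> R" using assms(2) fg U by blast
qed

lemma crible_comp:
  assumes "crible C X Y R" "(f, g) \<in> R" "f \<in> Hom C U Y" "h \<in> Hom C V U"
  shows "(f \<cdot> h, g \<cdot> h) \<in> R"
  using assms by (auto simp: crible_def Hom_def)

lemma crible_span:
  assumes "crible C X Y R" "(f, g) \<in> R"
  obtains U where "f \<in> Hom C U Y" "g \<in> Hom C U X"
proof -
  have "(f, g) \<in> spans C X Y" using assms(1,2) unfolding crible_def by blast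
  then show thesis using that spans_iff by blast
qed

text \<open>A cover that witnesses membership of \<open>(f, g)\<close>, pulled back along
  \<open>h\<close>, is a witness for the restricted span.\<close>

lemma closure_crible: "crible C X Y (crible_closure C J X Y R)"
proof (rule cribleI[OF closure_spans])
  fix f g h U V
  assume fg: "(f, g) \<in> crible_closure C J X Y R" and f: "f \<in> Hom C U Y" and g: "g \<in> Hom C U X"
    and h: "h \<in> Hom C V U"
  obtain S where S: "S \<in> J U" "\<And>s. s \<in> S \<Longrightarrow> (f \<cdot> s, g \<cdot> s) \<in> R"
    using fg unfolding closure_iff[OF f g] by blast
  have "((f \<cdot> h) \<cdot> s, (g \<cdot> h) \<cdot> s) \<in> R" if s: "s \<in> sieve_pullback C h S" for s
  proof -
    have "s \<in> Hom C (Dom C s) V" "h \<cdot> s \<in> S"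
      using s HomD(2)[OF h] by (auto simp: sieve_pullback_def Hom_def)
    then show ?thesis using comp_assoc[OF _ h f] comp_assoc[OF _ h g] S(2) by simp
  qed
  then show "(f \<cdot> h, g \<cdot> h) \<in> crible_closure C J X Y R"
    unfolding closure_iff[OF comp_in_Hom[OF h f] comp_in_Hom[OF h g]] using J_pullback[OF h S(1)]
    by blast
qed

lemma closure_extensive:
  assumes R: "crible C X Y R"
  shows "R \<subseteq> crible_closure C J X Y R"
proof (clarify)
  fix f g assume fg: "(f, g) \<in> R"
  obtain U where U: "f \<in> Hom C U Y" "g \<in> Hom C U X" using crible_span[OF R fg] .
  have "\<forall>s \<in> {s \<in> Arr C. Cod C s = U}. (f \<cdot> s, g \<cdot> s) \<in> R"
    using crible_comp[OF R fg U(1) HomI[OF _ refl]] by simp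
  then show "(f, g) \<in> crible_closure C J X Y R"
    unfolding closure_iff[OF U] using J_top[OF Hom_Ob(1)[OF U(1)]] by blast
qed

text \<open>The sieve \<open>T\<close> of all arrows along which the span restricts into
  \<open>R\<close> is covering by transitivity: along each \<open>s\<close> of the outer cover, its
  pullback contains the inner cover \<open>S'\<close>.\<close>

lemma closure_idem:
  assumes R: "crible C X Y R"
  shows "crible_closure C J X Y (crible_closure C J X Y R) = crible_closure C J X Y R"
    (is "?cl (?cl R) = ?cl R")
proof (rule antisym[OF _ closure_extensive[OF closure_crible]], clarify)
  fix f g assume fg: "(f, g) \<in> ?cl (?cl R)"
  obtain U where f: "f \<in> Hom C U Y" and g: "g \<in> Hom C U X"
    using crible_span[OF closure_crible fg] .
  obtain S where S: "S \<in> J U" "\<And>s. s \<in> S \<Longrightarrow> (f \<cdot> s, g \<cdot> s) \<in> ?cl R"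
    using fg unfolding closure_iff[OF f g] by blast
  have U: "U \<in> Ob C" using Hom_Ob f by blast
  define T where "T = {t \<in> Arr C. Cod C t = U \<and> (f \<cdot> t, g \<cdot> t) \<in> R}"
  \<comment> \<open>Needed for an arbitrary span, because the pullback of \<open>T\<close> along
    \<open>s\<close> is again such a sieve, now for the span
    \<open>(f \<cdot> s, g \<cdot> s)\<close>.\<close>
  have sieveT: "is_sieve C V {t \<in> Arr C. Cod C t = V \<and> (a \<cdot> t, b \<cdot> t) \<in> R}"
    if a: "a \<in> Hom C V Y" and b: "b \<in> Hom C V X" for a b V
    unfolding is_sieve_def
  proof (intro conjI ballI impI)
    fix t h assume t: "t \<in> {t \<in> Arr C. Cod C t = V \<and> (a \<cdot> t, b \<cdot> t) \<in> R}"
      and h: "h \<in> Arr C" "Cod C h = Dom C t"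
    have tH: "t \<in> Hom C (Dom C t) V" and hH: "h \<in> Hom C (Dom C h) (Dom C t)"
      using t h by (auto simp: Hom_def)
    have "((a \<cdot> t) \<cdot> h, (b \<cdot> t) \<cdot> h) \<in> R"
      using crible_comp[OF R _ comp_in_Hom[OF tH a] hH] t by blast
    then show "t \<cdot> h \<in> {t \<in> Arr C. Cod C t = V \<and> (a \<cdot> t, b \<cdot> t) \<in> R}"
      using comp_assoc[OF hH tH a] comp_assoc[OF hH tH b] HomD[OF comp_in_Hom[OF hH tH]] by simp
  qed blast
  have "T \<in> J U"
  proof (rule J_trans[OF U S(1)])
    show "is_sieve C U T" using sieveT[OF f g] by (simp add: T_def)
    fix s assume s: "s \<in> S"
    have sH: "s \<in> Hom C (Dom C s) U" using J_Hom[OF U S(1) s] .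
    obtain S' where S': "S' \<in> J (Dom C s)" "\<And>t. t \<in> S' \<Longrightarrow> ((f \<cdot> s) \<cdot> t, (g \<cdot> s) \<cdot> t) \<in> R"
      using S(2)[OF s] unfolding closure_iff[OF comp_in_Hom[OF sH f] comp_in_Hom[OF sH g]] by blast
    have D: "Dom C s \<in> Ob C" using Hom_Ob sH by blast
    have "s \<cdot> t \<in> Arr C \<and> Cod C (s \<cdot> t) = U \<and> (f \<cdot> s) \<cdot> t = f \<cdot> (s \<cdot> t) \<and> (g \<cdot> s) \<cdot> t = g \<cdot> (s \<cdot> t)"
      if "t \<in> Arr C" "Cod C t = Dom C s" for t
    proof -
      have tH: "t \<in> Hom C (Dom C t) (Dom C s)" using that by (simp add: Hom_def)
      show ?thesis
        using HomD[OF comp_in_Hom[OF tH sH]] comp_assoc[OF tH sH f] comp_assoc[OF tH sH g] by simp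
    qed
    then have "sieve_pullback C s T =
        {t \<in> Arr C. Cod C t = Dom C s \<and> ((f \<cdot> s) \<cdot> t, (g \<cdot> s) \<cdot> t) \<in> R}"
      unfolding sieve_pullback_def T_def mem_Collect_eq by (intro Collect_cong) metis
    moreover have "S' \<subseteq> \<dots>"
      using S'(2) HomD(1,3)[OF J_Hom[OF D S'(1)]] by blast
    ultimately show "sieve_pullback C s T \<in> J (Dom C s)"
      using J_superset[OF D S'(1) sieveT[OF comp_in_Hom[OF sH f] comp_in_Hom[OF sH g]]] by simp
  qed
  then show "(f, g) \<in> ?cl R"
    unfolding closure_iff[OF f g] by (rule bexI[rotated]) (simp add: T_def)
qed

section \<open>Arrows, composites and identities of closed cribles\<close>

lemma K_simps [simp]:
  "Ob K = Ob C"
  "Id K X = (X, X, crible_closure C J X X (Id_on {f \<in> Arr C. Cod C f = X}))"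
  "(Y', Z, S) \<cdot>\<^bsub>K\<^esub> (X, Y, R) = (X, Z, crible_closure C J X Z (S O R))"
  "Le K p q \<longleftrightarrow> crib p \<subseteq> crib q"
  by (auto simp: closed_cribles_def split: prod.splits)

lemma Hom_K: "p \<in> Hom K X Y \<longleftrightarrow> (\<exists>R. p = (X, Y, R) \<and> X \<in> Ob C \<and> Y \<in> Ob C \<and> crible C X Y R \<and>
    crible_closure C J X Y R = R)"
  by (auto simp: Hom_def closed_cribles_def)

lemma closure_Hom_K:
  assumes "X \<in> Ob C" "Y \<in> Ob C" "crible C X Y R"
  shows "(X, Y, crible_closure C J X Y R) \<in> Hom K X Y"
  using assms closure_idem closure_crible by (auto simp: Hom_K)

lemma K_span:
  assumes "p \<in> Hom K X Y" "(f, g) \<in> crib p"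
  obtains U where "f \<in> Hom C U Y" "g \<in> Hom C U X"
  using assms crible_span unfolding Hom_K by force

lemma K_precomp:
  assumes "p \<in> Hom K X Y" "(f, g) \<in> crib p" "f \<in> Hom C U Y" "h \<in> Hom C V U"
  shows "(f \<cdot> h, g \<cdot> h) \<in> crib p"
  using assms crible_comp unfolding Hom_K by force

text \<open>This is how closedness is used throughout: membership in an arrow of \<open>K\<close>
  may be checked on a cover.\<close>

lemma K_local:
  assumes "p \<in> Hom K X Y" "f \<in> Hom C U Y" "g \<in> Hom C U X" "S \<in> J U"
    "\<And>s. s \<in> S \<Longrightarrow> (f \<cdot> s, g \<cdot> s) \<in> crib p"
  shows "(f, g) \<in> crib p"
proof -
  have "(f, g) \<in> crible_closure C J X Y (crib p)"
    unfolding closure_iff[OF assms(2,3)] using assms(4,5) by blast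
  then show ?thesis using assms(1) by (auto simp: Hom_K)
qed

lemma relcomp_crible:
  assumes "crible C X Y R" "crible C Y Z S"
  shows "crible C X Z (S O R)"
proof (rule cribleI)
  show "S O R \<subseteq> spans C X Z"
  proof clarify
    fix f t g assume ft: "(f, t) \<in> S" and tg: "(t, g) \<in> R"
    obtain U where "f \<in> Hom C U Z" "t \<in> Hom C U Y" using crible_span[OF assms(2) ft] .
    moreover obtain V where "t \<in> Hom C V Y" "g \<in> Hom C V X" using crible_span[OF assms(1) tg] .
    ultimately show "(f, g) \<in> spans C X Z" using HomD(2) spans_iff by metis
  qed
  fix f g h U V assume fg: "(f, g) \<in> S O R" and f: "f \<in> Hom C U Z" and h: "h \<in> Hom C V U"
  obtain t where ft: "(f, t) \<in> S" and tg: "(t, g) \<in> R" using fg by blast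
  obtain U' where f': "f \<in> Hom C U' Z" and t: "t \<in> Hom C U' Y" using crible_span[OF assms(2) ft] .
  have "t \<in> Hom C U Y" using t HomD(2)[OF f'] HomD(2)[OF f] by simp
  then show "(f \<cdot> h, g \<cdot> h) \<in> S O R"
    using crible_comp[OF assms(2) ft f h] crible_comp[OF assms(1) tg _ h] by blast
qed

lemma K_comp_Hom:
  assumes "p \<in> Hom K X Y" "q \<in> Hom K Y Z"
  shows "q \<cdot>\<^bsub>K\<^esub> p \<in> Hom K X Z"
  using assms closure_Hom_K relcomp_crible by (auto simp: Hom_K[of p] Hom_K[of q])

lemma K_comp_iff:
  assumes "p \<in> Hom K X Y" "q \<in> Hom K Y Z" "f \<in> Hom C U Z" "g \<in> Hom C U X"
  shows "(f, g) \<in> crib (q \<cdot>\<^bsub>K\<^esub> p) \<longleftrightarrow>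
    (\<exists>S \<in> J U. \<forall>s \<in> S. \<exists>t. (f \<cdot> s, t) \<in> crib q \<and> (t, g \<cdot> s) \<in> crib p)"
proof -
  obtain P R where "p = (X, Y, P)" "q = (Y, Z, R)"
    using assms(1,2) by (auto simp: Hom_K)
  then show ?thesis using closure_iff[OF assms(3,4), of "R O P"] by (simp add: relcomp_unfold)
qed

lemma K_compI:
  assumes p: "p \<in> Hom K X Y" and q: "q \<in> Hom K Y Z" and ft: "(f, t) \<in> crib q" and tg: "(t, g) \<in> crib p"
  shows "(f, g) \<in> crib (q \<cdot>\<^bsub>K\<^esub> p)"
proof -
  obtain P R where "p = (X, Y, P)" "q = (Y, Z, R)" "crible C X Y P" "crible C Y Z R"
    using p q by (auto simp: Hom_K)
  then show ?thesis
    using closure_extensive[OF relcomp_crible, of X Y P Z R] ft tg by auto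
qed

text \<open>A composite is the closure of the relational composite and \<open>r\<close> is closed,
  so genuinely composable pairs suffice.\<close>

lemma K_comp_le:
  assumes p: "p \<in> Hom K X Y" and q: "q \<in> Hom K Y Z" and r: "r \<in> Hom K X Z"
    and le: "\<And>f t g. (f, t) \<in> crib q \<Longrightarrow> (t, g) \<in> crib p \<Longrightarrow> (f, g) \<in> crib r"
  shows "crib (q \<cdot>\<^bsub>K\<^esub> p) \<subseteq> crib r"
proof clarify
  fix f g assume fg: "(f, g) \<in> crib (q \<cdot>\<^bsub>K\<^esub> p)"
  obtain U where f: "f \<in> Hom C U Z" and g: "g \<in> Hom C U X" using K_span[OF K_comp_Hom[OF p q] fg] .
  obtain S where "S \<in> J U" "\<And>s. s \<in> S \<Longrightarrow> \<exists>t. (f \<cdot> s, t) \<in> crib q \<and> (t, g \<cdot> s) \<in> crib p"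
    using fg K_comp_iff[OF p q f g] by blast
  then show "(f, g) \<in> crib r" using K_local[OF r f g] le by blast
qed

lemma Id_crible: "crible C X X (Id_on {f \<in> Arr C. Cod C f = X})"
proof (rule cribleI)
  show "Id_on {f \<in> Arr C. Cod C f = X} \<subseteq> spans C X X"
    unfolding Id_on_def by (auto simp: spans_iff Hom_def)
  fix f g h U V assume "(f, g) \<in> Id_on {f \<in> Arr C. Cod C f = X}" "f \<in> Hom C U X" "h \<in> Hom C V U"
  then show "(f \<cdot> h, g \<cdot> h) \<in> Id_on {f \<in> Arr C. Cod C f = X}"
    using comp_in_Hom[of h V U f X] by (auto simp: Hom_def)
qed

lemma K_Id_Hom: "X \<in> Ob C \<Longrightarrow> Id K X \<in> Hom K X X"
  using closure_Hom_K Id_crible by simp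

text \<open>The identity is local equality. It can be coarser than equality, since the
  representables need not be separated for \<open>J\<close>.\<close>

lemma K_Id_iff:
  assumes "f \<in> Hom C U X" "g \<in> Hom C U X"
  shows "(f, g) \<in> crib (Id K X) \<longleftrightarrow> (\<exists>S \<in> J U. \<forall>s \<in> S. f \<cdot> s = g \<cdot> s)"
proof -
  have "(f \<cdot> s, g \<cdot> s) \<in> Id_on {f \<in> Arr C. Cod C f = X} \<longleftrightarrow> f \<cdot> s = g \<cdot> s" if "s \<in> S" "S \<in> J U" for s S
    using comp_in_Hom[OF J_Hom[OF Hom_Ob(1)[OF assms(1)] that(2,1)] assms(1)]
    by (auto simp: Hom_def)
  then show ?thesis using closure_iff[OF assms] by auto
qed

lemma K_IdI: "f \<in> Hom C U X \<Longrightarrow> (f, f) \<in> crib (Id K X)"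
  using K_Id_iff J_top Hom_Ob by blast

lemma K_Id_le:
  assumes p: "p \<in> Hom K X X" and le: "\<And>f U. f \<in> Hom C U X \<Longrightarrow> (f, f) \<in> crib p"
  shows "crib (Id K X) \<subseteq> crib p"
proof clarify
  fix f g assume fg: "(f, g) \<in> crib (Id K X)"
  have X: "X \<in> Ob C" using p by (auto simp: Hom_K)
  obtain U where f: "f \<in> Hom C U X" and g: "g \<in> Hom C U X" using K_span[OF K_Id_Hom[OF X] fg] .
  obtain S where S: "S \<in> J U" "\<And>s. s \<in> S \<Longrightarrow> f \<cdot> s = g \<cdot> s" using fg K_Id_iff[OF f g] by blast
  have "(f \<cdot> s, g \<cdot> s) \<in> crib p" if "s \<in> S" for s
    using le[OF comp_in_Hom[OF J_Hom[OF Hom_Ob(1)[OF f] S(1) that] f]] S(2)[OF that] by simp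
  then show "(f, g) \<in> crib p" using K_local[OF p f g S(1)] by blast
qed

text \<open>The closed crible generated by one span. With an identity as right leg \<open>g\<close>
  it is the graph of \<open>f\<close>, with an identity as left leg \<open>f\<close> the converse
  graph of \<open>g\<close>.\<close>

definition gen :: "'a \<Rightarrow> 'a \<Rightarrow> 'c \<times> 'c \<times> ('a \<times> 'a) set" where
  "gen f g = (Cod C g, Cod C f, crible_closure C J (Cod C g) (Cod C f)
     {(f \<cdot> h, g \<cdot> h) | h. h \<in> Arr C \<and> Cod C h = Dom C f})"

lemma gen_crible:
  assumes f: "f \<in> Hom C U Y" and g: "g \<in> Hom C U X"
  shows "crible C X Y {(f \<cdot> h, g \<cdot> h) | h. h \<in> Arr C \<and> Cod C h = Dom C f}"
    (is "crible C X Y ?R")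
proof (rule cribleI)
  have R: "x \<in> ?R \<longleftrightarrow> (\<exists>V h. h \<in> Hom C V U \<and> x = (f \<cdot> h, g \<cdot> h))" for x
    using HomD(2)[OF f] by (auto simp: Hom_def)
  show "?R \<subseteq> spans C X Y"
    unfolding subset_iff R using comp_in_Hom[OF _ f] comp_in_Hom[OF _ g] spans_iff by blast
  fix a b h V W assume ab: "(a, b) \<in> ?R" and a: "a \<in> Hom C V Y" and h: "h \<in> Hom C W V"
  obtain V' k where k: "k \<in> Hom C V' U" "a = f \<cdot> k" "b = g \<cdot> k" using ab R[of "(a, b)"] by blast
  have "V' = V" using HomD(2)[OF comp_in_Hom[OF k(1) f]] HomD(2)[OF a] k(2) by simp
  then show "(a \<cdot> h, b \<cdot> h) \<in> ?R"
    using R[of "(a \<cdot> h, b \<cdot> h)"] comp_assoc[OF h _ f] comp_assoc[OF h _ g] comp_in_Hom[OF h] k by metis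
qed

lemma gen_Hom:
  assumes "f \<in> Hom C U Y" "g \<in> Hom C U X"
  shows "gen f g \<in> Hom K X Y"
  using closure_Hom_K[OF Hom_Ob(2)[OF assms(2)] Hom_Ob(2)[OF assms(1)] gen_crible[OF assms]]
    HomD(3)[OF assms(1)] HomD(3)[OF assms(2)] by (simp add: gen_def)

lemma gen_mem:
  assumes f: "f \<in> Hom C U Y" and g: "g \<in> Hom C U X" and h: "h \<in> Hom C V U"
  shows "(f \<cdot> h, g \<cdot> h) \<in> crib (gen f g)"
  using closure_extensive[OF gen_crible[OF f g]] HomD[OF f] HomD[OF g] HomD[OF h]
  by (auto simp: gen_def)

lemma gen_local:
  assumes f: "f \<in> Hom C U Y" and g: "g \<in> Hom C U X" and a: "a \<in> Hom C V Y" and b: "b \<in> Hom C V X"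
    and ab: "(a, b) \<in> crib (gen f g)"
  obtains S where "S \<in> J V"
    "\<And>s. s \<in> S \<Longrightarrow> \<exists>h \<in> Hom C (Dom C s) U. a \<cdot> s = f \<cdot> h \<and> b \<cdot> s = g \<cdot> h"
proof -
  obtain S where S: "S \<in> J V" and
    *: "\<And>s. s \<in> S \<Longrightarrow> (a \<cdot> s, b \<cdot> s) \<in> {(f \<cdot> h, g \<cdot> h) | h. h \<in> Arr C \<and> Cod C h = Dom C f}"
    using ab closure_iff[OF a b] HomD[OF f] HomD[OF g] unfolding gen_def by auto
  have "\<exists>h \<in> Hom C (Dom C s) U. a \<cdot> s = f \<cdot> h \<and> b \<cdot> s = g \<cdot> h" if s: "s \<in> S" for s
  proof -
    obtain h where h: "h \<in> Arr C" "Cod C h = Dom C f" "a \<cdot> s = f \<cdot> h" "b \<cdot> s = g \<cdot> h"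
      using *[OF s] by blast
    have hH: "h \<in> Hom C (Dom C h) U" using h HomD(2)[OF f] by (simp add: Hom_def)
    have "s \<in> Hom C (Dom C s) V" using J_Hom[OF Hom_Ob(1)[OF a] S s] .
    then have "Dom C h = Dom C s"
      using HomD(2)[OF comp_in_Hom[OF hH f]] HomD(2)[OF comp_in_Hom[OF _ a]] h(3) by metis
    then show ?thesis using h hH by auto
  qed
  then show thesis using that S by blast
qed

text \<open>Membership in a graph, or in a converse graph, means being a value of \<open>c\<close>
  only after restriction to a cover.\<close>

lemma graph_local:
  assumes c: "c \<in> Hom C U X" and a: "a \<in> Hom C V X" and t: "t \<in> Hom C V U"
    and m: "(a, t) \<in> crib (gen c (Id C U)) \<or> (t, a) \<in> crib (gen (Id C U) c)"
  obtains S where "S \<in> J V" "\<And>s. s \<in> S \<Longrightarrow> a \<cdot> s = c \<cdot> (t \<cdot> s)"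
proof -
  have U: "Id C U \<in> Hom C U U" using id_in_Hom Hom_Ob c by blast
  from m obtain S where S: "S \<in> J V"
    "\<And>s. s \<in> S \<Longrightarrow> \<exists>h \<in> Hom C (Dom C s) U. a \<cdot> s = c \<cdot> h \<and> t \<cdot> s = Id C U \<cdot> h"
  proof
    assume "(a, t) \<in> crib (gen c (Id C U))"
    then show thesis using that gen_local[OF c U a t] by blast
  next
    assume "(t, a) \<in> crib (gen (Id C U) c)"
    then show thesis using that gen_local[OF U c t a] by metis
  qed
  have "a \<cdot> s = c \<cdot> (t \<cdot> s)" if "s \<in> S" for s
    using S(2)[OF that] id_comp by auto
  then show thesis using that S(1) by blast
qed

text \<open>The composite of a graph with a converse graph is the least arrow of \<open>K\<close>
  that contains the span \<open>(f, g)\<close>; \<open>graph_comp_mem\<close> says that it contains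
  it.\<close>

lemma graph_comp_le:
  assumes f: "f \<in> Hom C U Y" and g: "g \<in> Hom C U X" and p: "p \<in> Hom K X Y"
    and loc: "\<And>V h. h \<in> Hom C V U \<Longrightarrow> (f \<cdot> h, g \<cdot> h) \<in> crib p"
  shows "Le K (gen f (Id C U) \<cdot>\<^bsub>K\<^esub> gen (Id C U) g) p"
proof -
  have U: "Id C U \<in> Hom C U U" using id_in_Hom Hom_Ob f by blast
  have "crib (gen f (Id C U) \<cdot>\<^bsub>K\<^esub> gen (Id C U) g) \<subseteq> crib p"
  proof (rule K_comp_le[OF gen_Hom[OF U g] gen_Hom[OF f U] p])
    fix a t b assume at: "(a, t) \<in> crib (gen f (Id C U))" and tb: "(t, b) \<in> crib (gen (Id C U) g)"
    obtain V where a: "a \<in> Hom C V Y" and t: "t \<in> Hom C V U" using K_span[OF gen_Hom[OF f U] at] .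
    obtain V' where t': "t \<in> Hom C V' U" and "b \<in> Hom C V' X" using K_span[OF gen_Hom[OF U g] tb] .
    then have b: "b \<in> Hom C V X" using HomD(2)[OF t] HomD(2)[OF t'] by simp
    have V: "V \<in> Ob C" using Hom_Ob a by blast
    obtain S where S: "S \<in> J V" "\<And>s. s \<in> S \<Longrightarrow> a \<cdot> s = f \<cdot> (t \<cdot> s)"
      using graph_local[OF f a t] at by blast
    obtain T where T: "T \<in> J V" "\<And>s. s \<in> T \<Longrightarrow> b \<cdot> s = g \<cdot> (t \<cdot> s)"
      using graph_local[OF g b t] tb by blast
    show "(a, b) \<in> crib p"
    proof (rule K_local[OF p a b J_Int[OF V S(1) T(1)]])
      fix s assume s: "s \<in> S \<inter> T"
      have "t \<cdot> s \<in> Hom C (Dom C s) U" using comp_in_Hom[OF J_Hom[OF V S(1)] t] s by blast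
      then show "(a \<cdot> s, b \<cdot> s) \<in> crib p" using loc S(2) T(2) s by simp
    qed
  qed
  then show ?thesis by simp
qed

lemma graph_comp_mem:
  assumes f: "f \<in> Hom C U Y" and g: "g \<in> Hom C U X"
  shows "(f, g) \<in> crib (gen f (Id C U) \<cdot>\<^bsub>K\<^esub> gen (Id C U) g)"
proof -
  have U: "Id C U \<in> Hom C U U" using id_in_Hom Hom_Ob f by blast
  show ?thesis
    using K_compI[OF gen_Hom[OF U g] gen_Hom[OF f U] gen_mem[OF f U U] gen_mem[OF U g U]]
      comp_id[OF f] comp_id[OF g] by simp
qed

text \<open>An element \<open>f\<close> of \<open>U\<close> is related to itself through its image
  \<open>c \<cdot> f\<close>.\<close>

lemma graph_unit:
  assumes c: "c \<in> Hom C U X"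
  shows "Le K (Id K U) (gen (Id C U) c \<cdot>\<^bsub>K\<^esub> gen c (Id C U))"
proof -
  have U: "Id C U \<in> Hom C U U" using id_in_Hom Hom_Ob c by blast
  note H = gen_Hom[OF c U] gen_Hom[OF U c]
  have "(f, f) \<in> crib (gen (Id C U) c \<cdot>\<^bsub>K\<^esub> gen c (Id C U))" if f: "f \<in> Hom C V U" for f V
    using K_compI[OF H gen_mem[OF U c f] gen_mem[OF c U f]] id_comp[OF f] by simp
  then have "crib (Id K U) \<subseteq> crib (gen (Id C U) c \<cdot>\<^bsub>K\<^esub> gen c (Id C U))"
    using K_Id_le[OF K_comp_Hom[OF H]] by blast
  then show ?thesis by (simp del: K_simps(2))
qed

lemma graph_adjoint:
  assumes c: "c \<in> Hom C U X"
  shows "adjoint K (gen c (Id C U)) (gen (Id C U) c)"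
proof -
  have U: "Id C U \<in> Hom C U U" and X: "X \<in> Ob C" using id_in_Hom Hom_Ob c by blast+
  note H = gen_Hom[OF c U] gen_Hom[OF U c]
  have "Le K (gen c (Id C U) \<cdot>\<^bsub>K\<^esub> gen (Id C U) c) (Id K X)"
    using graph_comp_le[OF c c K_Id_Hom[OF X]] K_IdI[OF comp_in_Hom[OF _ c]] by blast
  then show ?thesis
    using graph_unit[OF c] H HomD[OF H(1)] unfolding adjoint_def by metis
qed

text \<open>As for relations between sets: if \<open>p\<close> is total, \<open>q\<close> is single
  valued and \<open>p\<close> is contained in \<open>q\<close>, then they agree. The units express
  totality and the counit single-valuedness, each up to a cover.\<close>

lemma K_map_discrete:
  assumes p: "p \<in> Hom K X Y" and q: "q \<in> Hom K X Y" and p': "p' \<in> Hom K Y X" and q': "q' \<in> Hom K Y X"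
    and unit_p: "Le K (Id K X) (p' \<cdot>\<^bsub>K\<^esub> p)" and unit_q: "Le K (Id K X) (q' \<cdot>\<^bsub>K\<^esub> q)"
    and counit_q: "Le K (q \<cdot>\<^bsub>K\<^esub> q') (Id K Y)" and le: "Le K p q"
  shows "Le K q p"
proof -
  have "crib q \<subseteq> crib p"
  proof clarify
    fix y x assume yx: "(y, x) \<in> crib q"
    obtain U where y: "y \<in> Hom C U Y" and x: "x \<in> Hom C U X" using K_span[OF q yx] .
    have U: "U \<in> Ob C" using Hom_Ob x by blast
    have xx: "(x, x) \<in> crib (p' \<cdot>\<^bsub>K\<^esub> p)" "(x, x) \<in> crib (q' \<cdot>\<^bsub>K\<^esub> q)"
      using unit_p unit_q K_IdI[OF x] by (auto simp del: K_simps(2))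
    obtain S where S: "S \<in> J U" "\<And>s. s \<in> S \<Longrightarrow> \<exists>t. (x \<cdot> s, t) \<in> crib p' \<and> (t, x \<cdot> s) \<in> crib p"
      using xx(1) K_comp_iff[OF p p' x x] by blast
    obtain T where T: "T \<in> J U" "\<And>s. s \<in> T \<Longrightarrow> \<exists>t. (x \<cdot> s, t) \<in> crib q' \<and> (t, x \<cdot> s) \<in> crib q"
      using xx(2) K_comp_iff[OF q q' x x] by blast
    show "(y, x) \<in> crib p"
    proof (rule K_local[OF p y x J_Int[OF U S(1) T(1)]])
      fix s assume s: "s \<in> S \<inter> T"
      define V where "V = Dom C s"
      have sH: "s \<in> Hom C V U" using J_Hom[OF U S(1)] s by (simp add: V_def)
      have V: "V \<in> Ob C" using Hom_Ob sH by blast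
      have ys: "y \<cdot> s \<in> Hom C V Y" and xs: "x \<cdot> s \<in> Hom C V X" using comp_in_Hom sH y x by blast+
      \<comment> \<open>Here \<open>t\<close> is a value of \<open>p\<close> at
        \<open>x \<cdot> s\<close>, and \<open>t'\<close> is an element to which both values
        \<open>y \<cdot> s\<close> and \<open>t\<close> of \<open>q\<close> can be compared by means
        of \<open>q \<cdot> q' \<le> 1\<close>. All three agree after a further restriction, which
        moves \<open>p\<close> from \<open>t\<close> to \<open>y \<cdot> s\<close>.\<close>
      obtain t where t: "(t, x \<cdot> s) \<in> crib p" using S(2) s by blast
      obtain t' where t': "(x \<cdot> s, t') \<in> crib q'" using T(2) s by blast
      have tH: "t \<in> Hom C V Y" using K_span[OF p t] HomD(2)[OF xs] HomD(2) by metis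
      have t'H: "t' \<in> Hom C V Y" using K_span[OF q' t'] HomD(2)[OF xs] HomD(2) by metis
      have "(y \<cdot> s, x \<cdot> s) \<in> crib q" using K_precomp[OF q yx y sH] .
      moreover have "(t, x \<cdot> s) \<in> crib q" using t le by auto
      ultimately have "(y \<cdot> s, t') \<in> crib (Id K Y)" "(t, t') \<in> crib (Id K Y)"
        using K_compI[OF q' q _ t'] counit_q by (auto simp del: K_simps(2))
      then obtain A B where A: "A \<in> J V" "\<And>w. w \<in> A \<Longrightarrow> (y \<cdot> s) \<cdot> w = t' \<cdot> w"
        and B: "B \<in> J V" "\<And>w. w \<in> B \<Longrightarrow> t \<cdot> w = t' \<cdot> w"
        using K_Id_iff[OF ys t'H] K_Id_iff[OF tH t'H] by blast
      show "(y \<cdot> s, x \<cdot> s) \<in> crib p"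
      proof (rule K_local[OF p ys xs J_Int[OF V A(1) B(1)]])
        fix w assume w: "w \<in> A \<inter> B"
        have "w \<in> Hom C (Dom C w) V" using J_Hom[OF V A(1)] w by blast
        then have "(t \<cdot> w, (x \<cdot> s) \<cdot> w) \<in> crib p" using K_precomp[OF p t tH] by blast
        then show "((y \<cdot> s) \<cdot> w, (x \<cdot> s) \<cdot> w) \<in> crib p" using A(2) B(2) w by simp
      qed
    qed
  qed
  then show ?thesis by simp
qed

end

section \<open>Transfer along an equivalence\<close>

lemma sup_functor_Hom:
  assumes "sup_functor A B Fo Fa" "f \<in> Hom A X Y"
  shows "Fa f \<in> Hom B (Fo X) (Fo Y)"
  using assms by (auto simp: sup_functor_def is_functor_def Hom_def)

lemma sup_functor_comp:
  assumes "sup_functor A B Fo Fa" "f \<in> Hom A X Y" "g \<in> Hom A Y Z"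
  shows "Fa (g \<cdot>\<^bsub>A\<^esub> f) = Fa g \<cdot>\<^bsub>B\<^esub> Fa f"
  using assms by (auto simp: sup_functor_def is_functor_def Hom_def)

lemma sup_functor_Id:
  assumes "sup_functor A B Fo Fa" "X \<in> Ob A"
  shows "Fo X \<in> Ob B" "Fa (Id A X) = Id B (Fo X)"
  using assms by (auto simp: sup_functor_def is_functor_def)

lemma sup_functor_Sup:
  assumes "sup_functor A B Fo Fa" "X \<in> Ob A" "Y \<in> Ob A" "S \<subseteq> Hom A X Y"
  shows "Fa (\<Squnion>\<^bsub>hom_order A X Y\<^esub> S) = \<Squnion>\<^bsub>hom_order B (Fo X) (Fo Y)\<^esub> (Fa ` S)"
  using assms by (auto simp: sup_functor_def sup_pres_def)

text \<open>Completeness of the codomain is part of \<open>sup_pres\<close>. The hom-lattices of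
  closed cribles are known to be complete through this fact, with no explicit construction of their
  suprema.\<close>

lemma sup_functor_complete_lattice:
  assumes "sup_functor A B Fo Fa" "X \<in> Ob A" "Y \<in> Ob A"
  shows "complete_lattice (hom_order B (Fo X) (Fo Y))"
  using assms by (auto simp: sup_functor_def sup_pres_def)

lemma sup_functor_mono:
  assumes "sup_functor A B Fo Fa" "X \<in> Ob A" "Y \<in> Ob A" "f \<in> Hom A X Y" "g \<in> Hom A X Y" "Le A f g"
  shows "Le B (Fa f) (Fa g)"
  using sup_pres_mono[of "hom_order A X Y" "hom_order B (Fo X) (Fo Y)" Fa f g] assms
    sup_functor_Hom[OF assms(1)] by (simp add: sup_functor_def)

text \<open>Up to the isomorphism \<open>\<eta>\<close>, \<open>Q\<close> is a retract of the closed
  cribles, and properties expressed by order and left adjoints descend along it.\<close>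

locale crible_retract = Q: quantaloid Q + site C J
  for Q :: "('o, 'm, 'y) qtld_scheme" and C :: "('c, 'a, 'z) cat_scheme" and J +
  fixes Fo :: "'o \<Rightarrow> 'c" and Fa Go Ga \<eta>
  assumes F: "sup_functor Q (closed_cribles C J) Fo Fa"
    and G: "sup_functor (closed_cribles C J) Q Go Ga"
    and \<eta>: "natural_iso Q Q id id (Go \<circ> Fo) (Ga \<circ> Fa) \<eta>"
begin

definition \<theta> :: "'o \<Rightarrow> 'm" where
  "\<theta> X = (SOME g. g \<in> Hom Q (Go (Fo X)) X \<and> g \<cdot>\<^bsub>Q\<^esub> \<eta> X = Id Q X \<and>
     \<eta> X \<cdot>\<^bsub>Q\<^esub> g = Id Q (Go (Fo X)))"

lemma \<eta>_\<theta>: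
  assumes "X \<in> Ob Q"
  shows "\<eta> X \<in> Hom Q X (Go (Fo X))" "\<theta> X \<in> Hom Q (Go (Fo X)) X"
    "\<theta> X \<cdot>\<^bsub>Q\<^esub> \<eta> X = Id Q X" "\<eta> X \<cdot>\<^bsub>Q\<^esub> \<theta> X = Id Q (Go (Fo X))"
proof -
  have *: "is_iso Q X (Go (Fo X)) (\<eta> X)" using \<eta> assms by (simp add: natural_iso_def)
  then show "\<eta> X \<in> Hom Q X (Go (Fo X))" by (simp add: is_iso_def)
  have "\<exists>g. g \<in> Hom Q (Go (Fo X)) X \<and> g \<cdot>\<^bsub>Q\<^esub> \<eta> X = Id Q X \<and> \<eta> X \<cdot>\<^bsub>Q\<^esub> g = Id Q (Go (Fo X))"
    using * by (auto simp: is_iso_def)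
  from someI_ex[OF this] show "\<theta> X \<in> Hom Q (Go (Fo X)) X" "\<theta> X \<cdot>\<^bsub>Q\<^esub> \<eta> X = Id Q X"
    "\<eta> X \<cdot>\<^bsub>Q\<^esub> \<theta> X = Id Q (Go (Fo X))"
    by (auto simp: \<theta>_def)
qed

lemma F_Ob: "X \<in> Ob Q \<Longrightarrow> Fo X \<in> Ob C"
  using sup_functor_Id(1)[OF F] by simp

lemma GF_conj:
  assumes q: "q \<in> Hom Q X Y"
  shows "\<theta> Y \<cdot>\<^bsub>Q\<^esub> (Ga (Fa q) \<cdot>\<^bsub>Q\<^esub> \<eta> X) = q"
proof -
  have X: "X \<in> Ob Q" and Y: "Y \<in> Ob Q" using Q.Hom_Ob q by blast+
  have "Ga (Fa q) \<cdot>\<^bsub>Q\<^esub> \<eta> X = \<eta> Y \<cdot>\<^bsub>Q\<^esub> q"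
    using \<eta> q by (auto simp: natural_iso_def Hom_def)
  then show ?thesis
    using Q.comp_assoc[OF q \<eta>_\<theta>(1,2)[OF Y]] \<eta>_\<theta>(3)[OF Y] Q.id_comp[OF q] by simp
qed

text \<open>\<open>Fa\<close> reflects the order because \<open>Ga\<close> is monotone and
  conjugating \<open>Ga (Fa q)\<close> with \<open>\<eta>\<close> returns \<open>q\<close>.\<close>

lemma Le_transfer:
  assumes q: "q \<in> Hom Q X Y" and r: "r \<in> Hom Q X Y" and le: "Le K (Fa q) (Fa r)"
  shows "Le Q q r"
proof -
  have X: "X \<in> Ob Q" and Y: "Y \<in> Ob Q" using Q.Hom_Ob q by blast+
  have Fq: "Fa q \<in> Hom K (Fo X) (Fo Y)" and Fr: "Fa r \<in> Hom K (Fo X) (Fo Y)"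
    using sup_functor_Hom[OF F] q r by blast+
  note GFq = sup_functor_Hom[OF G Fq] and GFr = sup_functor_Hom[OF G Fr]
  have "Le Q (Ga (Fa q)) (Ga (Fa r))"
    using sup_functor_mono[OF G _ _ Fq Fr le] F_Ob X Y by simp
  then have "Le Q (Ga (Fa q) \<cdot>\<^bsub>Q\<^esub> \<eta> X) (Ga (Fa r) \<cdot>\<^bsub>Q\<^esub> \<eta> X)"
    using Q.comp_mono_left[OF \<eta>_\<theta>(1)[OF X] GFq GFr] by blast
  then have "Le Q (\<theta> Y \<cdot>\<^bsub>Q\<^esub> (Ga (Fa q) \<cdot>\<^bsub>Q\<^esub> \<eta> X)) (\<theta> Y \<cdot>\<^bsub>Q\<^esub> (Ga (Fa r) \<cdot>\<^bsub>Q\<^esub> \<eta> X))"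
    using Q.comp_mono_right[OF Q.comp_in_Hom[OF \<eta>_\<theta>(1)[OF X] GFq]
        Q.comp_in_Hom[OF \<eta>_\<theta>(1)[OF X] GFr] \<eta>_\<theta>(2)[OF Y]] by blast
  then show ?thesis using GF_conj q r by simp
qed

text \<open>An arrow \<open>c: U \<rightarrow> Fo X\<close> of the site yields the left adjoint \<open>pt X c: Go U \<rightarrow> X\<close>, with right
  adjoint \<open>copt X c\<close>.\<close>

definition pt :: "'o \<Rightarrow> 'a \<Rightarrow> 'm" where
  "pt X c = \<theta> X \<cdot>\<^bsub>Q\<^esub> Ga (gen c (Id C (Dom C c)))"

definition copt :: "'o \<Rightarrow> 'a \<Rightarrow> 'm" where
  "copt X c = Ga (gen (Id C (Dom C c)) c) \<cdot>\<^bsub>Q\<^esub> \<eta> X"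

text \<open>Monotone functors preserve adjunctions, and \<open>\<theta> X\<close> is invertible with
  inverse, hence right adjoint, \<open>\<eta> X\<close>.\<close>

lemma pt_adjoint:
  assumes X: "X \<in> Ob Q" and c: "c \<in> Hom C U (Fo X)"
  shows "pt X c \<in> Hom Q (Go U) X" "adjoint Q (pt X c) (copt X c)"
proof -
  have U: "Id C U \<in> Hom C U U" and UO: "U \<in> Ob C" and FX: "Fo X \<in> Ob C"
    using id_in_Hom Hom_Ob c by blast+
  define g where "g = gen c (Id C U)"
  define g' where "g' = gen (Id C U) c"
  have g: "g \<in> Hom K U (Fo X)" and g': "g' \<in> Hom K (Fo X) U"
    using gen_Hom c U by (simp_all add: g_def g'_def)
  note Gg = sup_functor_Hom[OF G g] and Gg' = sup_functor_Hom[OF G g']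
  have "adjoint K g g'" using graph_adjoint[OF c] by (simp add: g_def g'_def)
  then have "Le K (Id K U) (g' \<cdot>\<^bsub>K\<^esub> g)" "Le K (g \<cdot>\<^bsub>K\<^esub> g') (Id K (Fo X))"
    using HomD[OF g] by (simp_all add: adjoint_def del: K_simps)
  then have "Le Q (Ga (Id K U)) (Ga (g' \<cdot>\<^bsub>K\<^esub> g))" "Le Q (Ga (g \<cdot>\<^bsub>K\<^esub> g')) (Ga (Id K (Fo X)))"
    using sup_functor_mono[OF G _ _ K_Id_Hom[OF UO] K_comp_Hom[OF g g']]
      sup_functor_mono[OF G _ _ K_comp_Hom[OF g' g] K_Id_Hom[OF FX]] UO FX K_simps(1) by blast+
  then have "Le Q (Id Q (Go U)) (Ga g' \<cdot>\<^bsub>Q\<^esub> Ga g)" "Le Q (Ga g \<cdot>\<^bsub>Q\<^esub> Ga g') (Id Q (Go (Fo X)))"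
    using sup_functor_comp[OF G g g'] sup_functor_comp[OF G g' g] sup_functor_Id(2)[OF G]
      UO FX K_simps(1) by simp_all
  then have adj: "adjoint Q (Ga g) (Ga g')" by (rule Q.adjointI[OF Gg Gg'])
  have "pt X c = \<theta> X \<cdot>\<^bsub>Q\<^esub> Ga g" "copt X c = Ga g' \<cdot>\<^bsub>Q\<^esub> \<eta> X"
    using HomD(2)[OF c] by (simp_all add: pt_def copt_def g_def g'_def)
  then show "pt X c \<in> Hom Q (Go U) X" "adjoint Q (pt X c) (copt X c)"
    using Q.adjoint_comp[OF adj Q.adjoint_inverse[OF \<eta>_\<theta>(2,1,4,3)[OF X]] Gg \<eta>_\<theta>(2)[OF X]]
      Q.comp_in_Hom[OF Gg \<eta>_\<theta>(2)[OF X]] by simp_all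
qed

text \<open>This has the shape of \<open>GF_conj\<close>: the composite corresponds in
  \<open>Q\<close> to the closed crible generated by \<open>(f, g)\<close>, so both can be compared
  with an arrow of \<open>Q\<close> in the same way.\<close>

lemma pt_copt:
  assumes X: "X \<in> Ob Q" and Y: "Y \<in> Ob Q" and f: "f \<in> Hom C U (Fo Y)" and g: "g \<in> Hom C U (Fo X)"
  shows "pt Y f \<cdot>\<^bsub>Q\<^esub> copt X g =
    \<theta> Y \<cdot>\<^bsub>Q\<^esub> (Ga (gen f (Id C U) \<cdot>\<^bsub>K\<^esub> gen (Id C U) g) \<cdot>\<^bsub>Q\<^esub> \<eta> X)"
proof -
  have U: "Id C U \<in> Hom C U U" using id_in_Hom Hom_Ob f by blast
  note Kf = gen_Hom[OF f U] and Kg = gen_Hom[OF U g]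
  note Gf = sup_functor_Hom[OF G Kf] and Gg = sup_functor_Hom[OF G Kg]
  have "pt Y f \<cdot>\<^bsub>Q\<^esub> copt X g =
      (\<theta> Y \<cdot>\<^bsub>Q\<^esub> Ga (gen f (Id C U))) \<cdot>\<^bsub>Q\<^esub> (Ga (gen (Id C U) g) \<cdot>\<^bsub>Q\<^esub> \<eta> X)"
    using HomD(2)[OF f] HomD(2)[OF g] by (simp add: pt_def copt_def)
  also have "\<dots> = \<theta> Y \<cdot>\<^bsub>Q\<^esub> ((Ga (gen f (Id C U)) \<cdot>\<^bsub>Q\<^esub> Ga (gen (Id C U) g)) \<cdot>\<^bsub>Q\<^esub> \<eta> X)"
    using Q.comp_assoc[OF Q.comp_in_Hom[OF \<eta>_\<theta>(1)[OF X] Gg] Gf \<eta>_\<theta>(2)[OF Y]]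
      Q.comp_assoc[OF \<eta>_\<theta>(1)[OF X] Gg Gf] by simp
  finally show ?thesis using sup_functor_comp[OF G Kg Kf] by simp
qed

lemma pt_copt_le:
  assumes q: "q \<in> Hom Q X Y" and fg: "(f, g) \<in> crib (Fa q)"
    and f: "f \<in> Hom C U (Fo Y)" and g: "g \<in> Hom C U (Fo X)"
  shows "Le Q (pt Y f \<cdot>\<^bsub>Q\<^esub> copt X g) q"
proof -
  have X: "X \<in> Ob Q" and Y: "Y \<in> Ob Q" using Q.Hom_Ob q by blast+
  have U: "Id C U \<in> Hom C U U" using id_in_Hom Hom_Ob f by blast
  define p where "p = gen f (Id C U) \<cdot>\<^bsub>K\<^esub> gen (Id C U) g"
  have p: "p \<in> Hom K (Fo X) (Fo Y)"
    using K_comp_Hom[OF gen_Hom[OF U g] gen_Hom[OF f U]] by (simp add: p_def)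
  have Fq: "Fa q \<in> Hom K (Fo X) (Fo Y)" using sup_functor_Hom[OF F] q by blast
  note Gp = sup_functor_Hom[OF G p] and Gq = sup_functor_Hom[OF G Fq]
  have "Le K p (Fa q)"
    unfolding p_def using graph_comp_le[OF f g Fq] K_precomp[OF Fq fg f] by blast
  then have "Le Q (Ga p) (Ga (Fa q))"
    using sup_functor_mono[OF G _ _ p Fq] F_Ob X Y by simp
  then have "Le Q (Ga p \<cdot>\<^bsub>Q\<^esub> \<eta> X) (Ga (Fa q) \<cdot>\<^bsub>Q\<^esub> \<eta> X)"
    using Q.comp_mono_left[OF \<eta>_\<theta>(1)[OF X] Gp Gq] by blast
  then have "Le Q (\<theta> Y \<cdot>\<^bsub>Q\<^esub> (Ga p \<cdot>\<^bsub>Q\<^esub> \<eta> X)) (\<theta> Y \<cdot>\<^bsub>Q\<^esub> (Ga (Fa q) \<cdot>\<^bsub>Q\<^esub> \<eta> X))"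
    using Q.comp_mono_right[OF Q.comp_in_Hom[OF \<eta>_\<theta>(1)[OF X] Gp]
        Q.comp_in_Hom[OF \<eta>_\<theta>(1)[OF X] Gq] \<eta>_\<theta>(2)[OF Y]] by blast
  then show ?thesis using pt_copt[OF X Y f g] GF_conj[OF q] by (simp add: p_def)
qed

text \<open>The common core of the last two transported properties. \<open>Fa q\<close> lies below
  the supremum of the cribles generated by the spans in \<open>B\<close>, and since
  \<open>Ga\<close> preserves that supremum, a bound on the generators bounds
  \<open>q\<close>.\<close>

lemma le_if_locally_pt_copt_le:
  assumes q: "q \<in> Hom Q X Y" and r: "r \<in> Hom Q X Y" and B: "B \<subseteq> spans C (Fo X) (Fo Y)"
    and loc: "\<And>f g U. (f, g) \<in> crib (Fa q) \<Longrightarrow> f \<in> Hom C U (Fo Y) \<Longrightarrow> g \<in> Hom C U (Fo X) \<Longrightarrow>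
      \<exists>S \<in> J U. \<forall>s \<in> S. (f \<cdot>\<^bsub>C\<^esub> s, g \<cdot>\<^bsub>C\<^esub> s) \<in> B"
    and le: "\<And>f g U. (f, g) \<in> B \<Longrightarrow> f \<in> Hom C U (Fo Y) \<Longrightarrow> g \<in> Hom C U (Fo X) \<Longrightarrow>
      Le Q (pt Y f \<cdot>\<^bsub>Q\<^esub> copt X g) r"
  shows "Le Q q r"
proof -
  have X: "X \<in> Ob Q" and Y: "Y \<in> Ob Q" using Q.Hom_Ob q by blast+
  note \<eta>X = \<eta>_\<theta>[OF X] and \<eta>Y = \<eta>_\<theta>[OF Y]
  have FX: "Fo X \<in> Ob K" and FY: "Fo Y \<in> Ob K" using F_Ob X Y by simp_all
  have Fq: "Fa q \<in> Hom K (Fo X) (Fo Y)" using sup_functor_Hom[OF F] q by blast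
  interpret L: complete_lattice "hom_order K (Fo X) (Fo Y)"
    using sup_functor_complete_lattice[OF F X Y] .
  define A where "A = {gen f (Id C U) \<cdot>\<^bsub>K\<^esub> gen (Id C U) g | f g U.
    (f, g) \<in> B \<and> f \<in> Hom C U (Fo Y) \<and> g \<in> Hom C U (Fo X)}"
  have A: "A \<subseteq> Hom K (Fo X) (Fo Y)"
  proof (clarsimp simp: A_def simp del: K_simps)
    fix f g U assume f: "f \<in> Hom C U (Fo Y)" and g: "g \<in> Hom C U (Fo X)"
    have U: "Id C U \<in> Hom C U U" using id_in_Hom Hom_Ob f by blast
    show "gen f (Id C U) \<cdot>\<^bsub>K\<^esub> gen (Id C U) g \<in> Hom K (Fo X) (Fo Y)"
      using K_comp_Hom[OF gen_Hom[OF U g] gen_Hom[OF f U]] .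
  qed
  \<comment> \<open>No formula for \<open>m\<close> is required: it contains \<open>B\<close>
    because it bounds the generators, and it is closed, so spans that lie locally in
    \<open>B\<close> belong to it.\<close>
  define m where "m = \<Squnion>\<^bsub>hom_order K (Fo X) (Fo Y)\<^esub> A"
  have m: "m \<in> Hom K (Fo X) (Fo Y)" using L.sup_closed[of A] A by (simp add: m_def)
  have Am: "Le K a m" if "a \<in> A" for a using L.sup_upper[of A a] A that by (simp add: m_def)
  have Bm: "(f, g) \<in> crib m" if fg: "(f, g) \<in> B" for f g
  proof -
    obtain U where f: "f \<in> Hom C U (Fo Y)" and g: "g \<in> Hom C U (Fo X)"
      using fg B spans_iff by blast
    have "gen f (Id C U) \<cdot>\<^bsub>K\<^esub> gen (Id C U) g \<in> A" using fg f g unfolding A_def by blast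
    then show ?thesis using Am graph_comp_mem[OF f g] K_simps(4) by blast
  qed
  have "crib (Fa q) \<subseteq> crib m"
  proof clarify
    fix f g assume fg: "(f, g) \<in> crib (Fa q)"
    obtain U where f: "f \<in> Hom C U (Fo Y)" and g: "g \<in> Hom C U (Fo X)" using K_span[OF Fq fg] .
    obtain S where "S \<in> J U" "\<forall>s \<in> S. (f \<cdot>\<^bsub>C\<^esub> s, g \<cdot>\<^bsub>C\<^esub> s) \<in> B" using loc[OF fg f g] by blast
    then show "(f, g) \<in> crib m" using K_local[OF m f g] Bm by blast
  qed
  then have le_m: "Le Q (Ga (Fa q)) (Ga m)"
    using sup_functor_mono[OF G FX FY Fq m] by simp
  \<comment> \<open>The conjugate of \<open>r\<close>. Being bounded by \<open>r'\<close> is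
    equivalent to the conjugate being bounded by \<open>r\<close>, so the supremum can be treated
    before returning to \<open>X\<close> and \<open>Y\<close>.\<close>
  define r' where "r' = \<eta> Y \<cdot>\<^bsub>Q\<^esub> (r \<cdot>\<^bsub>Q\<^esub> \<theta> X)"
  have r': "r' \<in> Hom Q (Go (Fo X)) (Go (Fo Y))"
    using Q.comp_in_Hom[OF Q.comp_in_Hom[OF \<eta>X(2) r] \<eta>Y(1)] by (simp add: r'_def)
  note GA = sup_functor_Hom[OF G]
  have conj_le: "Le Q a r' \<longleftrightarrow> Le Q (\<theta> Y \<cdot>\<^bsub>Q\<^esub> (a \<cdot>\<^bsub>Q\<^esub> \<eta> X)) r"
    if a: "a \<in> Hom Q (Go (Fo X)) (Go (Fo Y))" for a
  proof -
    have 1: "adjoint Q (\<theta> Y) (\<eta> Y)" "adjoint Q (\<theta> X) (\<eta> X)"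
      using Q.adjoint_inverse \<eta>X \<eta>Y by blast+
    have a\<eta>: "a \<cdot>\<^bsub>Q\<^esub> \<eta> X \<in> Hom Q X (Go (Fo Y))" using Q.comp_in_Hom[OF \<eta>X(1) a] .
    have \<eta>r: "\<eta> Y \<cdot>\<^bsub>Q\<^esub> r \<in> Hom Q X (Go (Fo Y))" using Q.comp_in_Hom[OF r \<eta>Y(1)] .
    show ?thesis
      using Q.adjoint_left_iff[OF 1(1) \<eta>Y(2) a\<eta> r] Q.adjoint_right_iff[OF 1(2) \<eta>X(2) a \<eta>r]
        Q.comp_assoc[OF \<eta>X(2) r \<eta>Y(1)] by (simp add: r'_def)
  qed
  have "Le Q (Ga m) r'"
    unfolding m_def sup_functor_Sup[OF G FX FY A]
  proof (rule Q.Sup_least[OF _ r'])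
    show "Ga ` A \<subseteq> Hom Q (Go (Fo X)) (Go (Fo Y))" using GA A by blast
    fix a assume "a \<in> Ga ` A"
    then obtain f g U where fg: "(f, g) \<in> B" and f: "f \<in> Hom C U (Fo Y)"
      and g: "g \<in> Hom C U (Fo X)" and a: "a = Ga (gen f (Id C U) \<cdot>\<^bsub>K\<^esub> gen (Id C U) g)"
      unfolding A_def by blast
    have "a \<in> Hom Q (Go (Fo X)) (Go (Fo Y))" using \<open>a \<in> Ga ` A\<close> GA A by blast
    then show "Le Q a r'"
      using conj_le le[OF fg f g] pt_copt[OF X Y f g] a by simp
  qed
  then have "Le Q (Ga (Fa q)) r'"
    using Q.le_trans[OF GA[OF Fq] GA[OF m] r'] le_m by blast
  then show ?thesis using conj_le[OF GA[OF Fq]] GF_conj[OF q] by simp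
qed

lemma tabular: "tabular_quantaloid Q"
proof
  fix f f' g g' X Y
  assume f': "adjoint Q f f'" and g': "adjoint Q g g'" and f: "f \<in> Hom Q X Y"
    and g: "g \<in> Hom Q X Y" and le: "Le Q f g"
  have X: "X \<in> Ob Q" and Y: "Y \<in> Ob Q" using Q.Hom_Ob f by blast+
  note adf = Q.adjointD[OF f' f] and adg = Q.adjointD[OF g' g]
  note FH = sup_functor_Hom[OF F] and FM = sup_functor_mono[OF F] and FC = sup_functor_comp[OF F]
    and FI = sup_functor_Id(2)[OF F]
  have "Le K (Id K (Fo X)) (Fa f' \<cdot>\<^bsub>K\<^esub> Fa f)"
    using FM[OF X X Q.id_in_Hom[OF X] Q.comp_in_Hom[OF f adf(1)] adf(2)] FC[OF f adf(1)] FI[OF X]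
    by metis
  moreover have "Le K (Id K (Fo X)) (Fa g' \<cdot>\<^bsub>K\<^esub> Fa g)"
    using FM[OF X X Q.id_in_Hom[OF X] Q.comp_in_Hom[OF g adg(1)] adg(2)] FC[OF g adg(1)] FI[OF X]
    by metis
  moreover have "Le K (Fa g \<cdot>\<^bsub>K\<^esub> Fa g') (Id K (Fo Y))"
    using FM[OF Y Y Q.comp_in_Hom[OF adg(1) g] Q.id_in_Hom[OF Y] adg(3)] FC[OF adg(1) g] FI[OF Y]
    by metis
  ultimately have "Le K (Fa g) (Fa f)"
    using K_map_discrete[OF FH[OF f] FH[OF g] FH[OF adf(1)] FH[OF adg(1)]] FM[OF X Y f g le] by blast
  then show "f = g" using Q.le_antisym[OF f g le] Le_transfer[OF g f] by blast
next
  fix q r X Y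
  assume q: "q \<in> Hom Q X Y" and r: "r \<in> Hom Q X Y"
    and le: "\<And>U f f' g g'. adjoint Q f f' \<Longrightarrow> adjoint Q g g' \<Longrightarrow> f \<in> Hom Q U Y \<Longrightarrow> g \<in> Hom Q U X \<Longrightarrow>
        Le Q (f \<cdot>\<^bsub>Q\<^esub> g') q \<Longrightarrow> Le Q (f \<cdot>\<^bsub>Q\<^esub> g') r"
  have X: "X \<in> Ob Q" and Y: "Y \<in> Ob Q" using Q.Hom_Ob q by blast+
  have Fq: "Fa q \<in> Hom K (Fo X) (Fo Y)" using sup_functor_Hom[OF F] q by blast
  show "Le Q q r"
  \<comment> \<open>All spans of \<open>Fa q\<close> are allowed, so the maximal sieve serves as the
    cover.\<close>
  proof (rule le_if_locally_pt_copt_le[OF q r, of "crib (Fa q)"])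
    show "crib (Fa q) \<subseteq> spans C (Fo X) (Fo Y)" using Fq by (auto simp: Hom_K crible_def)
  next
    fix f g U
    assume fg: "(f, g) \<in> crib (Fa q)" and f: "f \<in> Hom C U (Fo Y)" and g: "g \<in> Hom C U (Fo X)"
    have U: "U \<in> Ob C" using Hom_Ob f by blast
    show "\<exists>S \<in> J U. \<forall>s \<in> S. (f \<cdot>\<^bsub>C\<^esub> s, g \<cdot>\<^bsub>C\<^esub> s) \<in> crib (Fa q)"
      using K_precomp[OF Fq fg f] J_Hom[OF U] J_top[OF U] by blast
    show "Le Q (pt Y f \<cdot>\<^bsub>Q\<^esub> copt X g) r"
      using le pt_adjoint[OF Y f] pt_adjoint[OF X g] pt_copt_le[OF q fg f g] by blast
  qed
next
  fix r Y P
  assume r: "r \<in> Hom Q Y Y"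
    and P: "\<And>q p. (q, p) \<in> P \<Longrightarrow> \<exists>Z. p \<in> Hom Q Y Z \<and> q \<in> Hom Q Z Y"
    and cover: "Le Q (Id Q Y) (\<Squnion>\<^bsub>hom_order Q Y Y\<^esub> {q \<cdot>\<^bsub>Q\<^esub> p | q p. (q, p) \<in> P})"
    and le: "\<And>U h h' k k' q p. (q, p) \<in> P \<Longrightarrow> adjoint Q h h' \<Longrightarrow> adjoint Q k k' \<Longrightarrow>
      h \<in> Hom Q U Y \<Longrightarrow> k \<in> Hom Q U (Cod Q p) \<Longrightarrow> Le Q (k \<cdot>\<^bsub>Q\<^esub> h') p \<Longrightarrow> Le Q (h \<cdot>\<^bsub>Q\<^esub> h') r"
  have Y: "Y \<in> Ob Q" using Q.Hom_Ob r by blast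
  have FY: "Fo Y \<in> Ob C" using F_Ob Y .
  define D where "D = {q \<cdot>\<^bsub>Q\<^esub> p | q p. (q, p) \<in> P}"
  \<comment> \<open>The closure of \<open>M\<close> bounds every \<open>Fa (q \<cdot> p)\<close>. As
    \<open>Fa\<close> preserves suprema, it also bounds \<open>Fa\<close> of the identity.\<close>
  define M where "M = (\<Union>(q, p)\<in>P. crib (Fa q) O crib (Fa p))"
  define m where "m = (Fo Y, Fo Y, crible_closure C J (Fo Y) (Fo Y) M)"
  \<comment> \<open>Only diagonal spans are kept: those at an element \<open>h\<close> that some
    \<open>p\<close> of the family relates to an element \<open>t\<close>. The latter becomes the
    arrow \<open>k\<close> of the selection property.\<close>
  define B where "B = {(h, h) | h t U q p. h \<in> Hom C U (Fo Y) \<and> (q, p) \<in> P \<and> (t, h) \<in> crib (Fa p)}"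
  have D: "D \<subseteq> Hom Q Y Y" using P Q.comp_in_Hom unfolding D_def by blast
  have crib_crible: "crible C (Fo X) (Fo Z) (crib (Fa p))" if "p \<in> Hom Q X Z" for p X Z
    using sup_functor_Hom[OF F that] by (auto simp: Hom_K)
  have each: "crible C (Fo Y) (Fo Y) (crib (Fa q) O crib (Fa p))" if "(q, p) \<in> P" for q p
    using P[OF that] crib_crible relcomp_crible by blast
  have M: "crible C (Fo Y) (Fo Y) M"
    using each unfolding crible_def M_def by fast
  have m: "m \<in> Hom K (Fo Y) (Fo Y)" using closure_Hom_K[OF FY FY M] by (simp add: m_def)
  interpret L: complete_lattice "hom_order K (Fo Y) (Fo Y)"
    using sup_functor_complete_lattice[OF F Y Y] .
  have FD: "Fa ` D \<subseteq> Hom K (Fo Y) (Fo Y)" using sup_functor_Hom[OF F] D by blast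
  have Fd: "Le K (Fa d) m" if d: "d \<in> D" for d
  proof -
    obtain q p where qp: "d = q \<cdot>\<^bsub>Q\<^esub> p" "(q, p) \<in> P" using d unfolding D_def by blast
    obtain Z where Z: "p \<in> Hom Q Y Z" "q \<in> Hom Q Z Y" using P[OF qp(2)] by blast
    have "crib (Fa q \<cdot>\<^bsub>K\<^esub> Fa p) \<subseteq> crib m"
    proof (rule K_comp_le[OF sup_functor_Hom[OF F Z(1)] sup_functor_Hom[OF F Z(2)] m])
      fix f t g assume "(f, t) \<in> crib (Fa q)" "(t, g) \<in> crib (Fa p)"
      then have "(f, g) \<in> M" using qp(2) unfolding M_def by blast
      then show "(f, g) \<in> crib m" using closure_extensive[OF M] unfolding m_def by auto
    qed
    then show ?thesis using sup_functor_comp[OF F Z] qp(1) by simp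
  qed
  have "le (hom_order K (Fo Y) (Fo Y)) (\<Squnion>\<^bsub>hom_order K (Fo Y) (Fo Y)\<^esub> (Fa ` D)) m"
    by (intro L.sup_least) (use Fd FD m in \<open>auto simp del: K_simps(4)\<close>)
  moreover have "Le K (Fa (Id Q Y)) (Fa (\<Squnion>\<^bsub>hom_order Q Y Y\<^esub> D))"
    using sup_functor_mono[OF F Y Y Q.id_in_Hom[OF Y] Q.Sup_Hom[OF Y Y D]] cover
    unfolding D_def by blast
  ultimately have FIm: "crib (Fa (Id Q Y)) \<subseteq> crib m"
    using sup_functor_Sup[OF F Y Y D] by (simp del: K_simps(2))
  show "Le Q (Id Q Y) r"
  proof (rule le_if_locally_pt_copt_le[OF Q.id_in_Hom[OF Y] r, of B])
    show "B \<subseteq> spans C (Fo Y) (Fo Y)" unfolding B_def using spans_iff by blast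
  next
    fix f g U
    assume fg: "(f, g) \<in> crib (Fa (Id Q Y))" and f: "f \<in> Hom C U (Fo Y)" and g: "g \<in> Hom C U (Fo Y)"
    have U: "U \<in> Ob C" using Hom_Ob f by blast
    have "(f, g) \<in> crib (Id K (Fo Y))" using fg sup_functor_Id(2)[OF F Y] by (simp del: K_simps(2))
    then obtain S where S: "S \<in> J U" "\<And>s. s \<in> S \<Longrightarrow> f \<cdot>\<^bsub>C\<^esub> s = g \<cdot>\<^bsub>C\<^esub> s"
      using K_Id_iff[OF f g] by blast
    have "(f, g) \<in> crible_closure C J (Fo Y) (Fo Y) M" using fg FIm by (auto simp: m_def)
    then obtain T where T: "T \<in> J U" "\<And>s. s \<in> T \<Longrightarrow> (f \<cdot>\<^bsub>C\<^esub> s, g \<cdot>\<^bsub>C\<^esub> s) \<in> M"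
      unfolding closure_iff[OF f g] by blast
    \<comment> \<open>On \<open>S\<close> the two legs agree, because the span lies in the identity;
      on \<open>T\<close> it lies in \<open>M\<close>, so some \<open>p\<close> applies to
      \<open>g \<cdot> s\<close>.\<close>
    have "(f \<cdot>\<^bsub>C\<^esub> s, g \<cdot>\<^bsub>C\<^esub> s) \<in> B" if s: "s \<in> S \<inter> T" for s
    proof -
      have gs: "g \<cdot>\<^bsub>C\<^esub> s \<in> Hom C (Dom C s) (Fo Y)" using comp_in_Hom[OF J_Hom[OF U S(1)] g] s by blast
      obtain q p t where "(q, p) \<in> P" "(t, g \<cdot>\<^bsub>C\<^esub> s) \<in> crib (Fa p)"
        using T(2) s unfolding M_def by blast
      then show ?thesis using gs S(2) s unfolding B_def by auto
    qed
    then show "\<exists>S \<in> J U. \<forall>s \<in> S. (f \<cdot>\<^bsub>C\<^esub> s, g \<cdot>\<^bsub>C\<^esub> s) \<in> B"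
      using J_Int[OF U S(1) T(1)] by blast
  next
    fix f g U assume fg: "(f, g) \<in> B" and f: "f \<in> Hom C U (Fo Y)"
    obtain q p t where qp: "(q, p) \<in> P" and tf: "(t, f) \<in> crib (Fa p)" and eq: "g = f"
      using fg unfolding B_def by blast
    obtain Z where p: "p \<in> Hom Q Y Z" using P[OF qp] by blast
    have Z: "Z \<in> Ob Q" using Q.Hom_Ob p by blast
    have t: "t \<in> Hom C U (Fo Z)"
      using K_span[OF sup_functor_Hom[OF F p] tf] HomD(2)[OF f] HomD(2) by metis
    \<comment> \<open>The hypothesis is applied with \<open>pt Y f\<close> as \<open>h\<close> and
      \<open>pt Z t\<close> as \<open>k\<close>.\<close>
    show "Le Q (pt Y f \<cdot>\<^bsub>Q\<^esub> copt Y g) r"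
      using le[OF qp pt_adjoint(2)[OF Y f] pt_adjoint(2)[OF Z t] pt_adjoint(1)[OF Y f]]
        pt_adjoint(1)[OF Z t] pt_copt_le[OF p tf t f] HomD(3)[OF p] eq by simp
  qed
qed

end

theorem proposition4p5:
  fixes Q :: "('o, 'm) qtld"
  assumes "quantaloid Q"
    and "coreflexives_split Q"
  shows "(\<forall>J'. subcanonical (Map_cat Q) J' \<longrightarrow>
            (\<forall>C \<in> Ob (Map_cat Q). \<forall>S \<in> J' C. sieve_Sup Q C S = Id Q C)) \<and>
         (quantaloid_of_closed_cribles TYPE('c \<times> 'a) Q \<longrightarrow>
            canonical_topology (Map_cat Q) (Map_topology Q))"
proof (intro conjI allI impI ballI)
  interpret quantaloid Q by (rule assms)
  fix J' C S assume "subcanonical (Map_cat Q) J'" "C \<in> Ob (Map_cat Q)" "S \<in> J' C"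
  then show "sieve_Sup Q C S = Id Q C"
    using subcanonical_sieve_Sup[OF assms(2)] by simp
next
  assume "quantaloid_of_closed_cribles TYPE('c \<times> 'a) Q"
  then obtain C :: "('c, 'a) cat" and J Fo Fa Go Ga \<eta>
    where "category C" "grothendieck_topology C J"
      "sup_functor Q (closed_cribles C J) Fo Fa" "sup_functor (closed_cribles C J) Q Go Ga"
      "natural_iso Q Q id id (Go \<circ> Fo) (Ga \<circ> Fa) \<eta>"
    unfolding quantaloid_of_closed_cribles_def quantaloid_equivalent_def by blast
  then have "crible_retract Q C J Fo Fa Go Ga \<eta>"
    using assms(1) by (simp add: crible_retract_def crible_retract_axioms_def site_def site_axioms_def)
  then show "canonical_topology (Map_cat Q) (Map_topology Q)"
    using tabular_quantaloid.canonical_Map_topology[OF crible_retract.tabular] assms(2) by blast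
qed

end
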